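(* Let $\mathcal C_1,\mathcal C_2:\mathbb R^d\to\mathbb R^d$ be a $\delta_1$-approximate and a $\delta_2$-approximate compressor with $\delta_1\in(0,1]$, $\delta_2\in[0,1]$, let $H>0$ be the (integer) synchronization interval and $\beta\in[0,1)$ the momentum parameter. Assume the smoothness, gradient and global minimum assumptions stated in the context, with constants $L$, $V_1$, $V_1'$, $V_2=V_1+V_1'$ and global minimum $x_*$. Take $$\eta=\min\left\{\frac{\gamma}{\sqrt{T/n}+\left[2\left(4(1-\delta_1)/\delta_1^2+1\right)(1-\delta_2)H^2+1\right]^{1/3}T^{1/3}},\ \frac12\right\}$$ for some $\gamma>0$, let $(x_{i,t})$ be the iterates of M-CSER with step size $\eta$, and $\bar x_t=\frac1n\sum_{i\in[n]}x_{i,t}$. Then after $T\ge\frac{4\gamma^2L^2n}{(1-\beta)^2}$ iterations M-CSER converges to a critical point, in the sense that $$\frac1T\sum_{t=1}^T\mathbb E\big[\|\nabla F(\bar x_{t-1})\|^2\big]\le\frac1{\sqrt{nT}}\left[\frac{2(1-\beta)[F(\bar x_0)-F(x_* )]}{\gamma}+\frac{\gamma LV_1}{1-\beta}\right]+\frac{\left[2\left(4(1-\delta_1)/\delta_1^2+1\right)(1-\delta_2)H^2+1\right]^{1/3}}{T^{2/3}}\left[\frac{2(1-\beta)[F(\bar x_0)-F(x_* )]}{\gamma}+\frac{\gamma^2L^2V_2}{(1-\beta)^4}\right],$$ and $$\frac1T\sum_{t=1}^T\mathbb E\big[\|\nabla F(\bar x_{t-1})\|^2\big]\le\mathcal O\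left(\frac1{\sqrt{nT}}\right).$$
   Context: Notation: $[n]=\{1,\dots,n\}$, where $n$ is the number of workers; $\|\cdot\|$ is the Euclidean norm on $\mathbb R^d$. Problem: minimize $F(x)=\frac1n\sum_{i\in[n]}F_i(x)$ over $x\in\mathbb R^d$, where $F_i(x)=\mathbb E_{z_i\sim\mathcal D_i}f(x;z_i)$ and $z_i$ is sampled from the local data $\mathcal D_i$ of worker $i$; it is assumed that $\mathcal D_i\ne\mathcal D_j$ for $i\ne j$. $\nabla f(x;z)$ is the gradient in $x$. Compressor: $\mathcal C:\mathbb R^d\to\mathbb R^d$ is a $\delta$-approximate compressor, $\delta\in[0,1]$, if $\|\mathcal C(v)-v\|^2\le(1-\delta)\|v\|^2$ for all $v\in\mathbb R^d$. Partial synchronization: given vectors $v_1,\dots,v_n\in\mathbb R^d$ held by the $n$ workers, $\mathrm{PSync}(v_i,\mathcal C)$ returns to worker $i$ the pair $(v_i',r_i)$ with $r_i=v_i-\mathcal C(v_i)$ and $v_i'=\frac1n\sum_{k\in[n]}\mathcal C(v_k)+r_i$. M-CSER algorithm: initialize $x_{i,0}=\hat x_0\in\mathbb R^d$ (the same for all $i$), $e_{i,0}=0$, $m_{i,0}=0$. For $t=1,\dots,T$ and every worker $i\in[n]$: sample $z_{i,t}\sim\mathcal D_i$ and set $g_{i,t}=\nabla f(x_{i,t-1};z_{i,t})$; $m_{i,t}=\beta m_{i,t-1}+g_{i,t}$; $p_{i,t}=\eta(\beta m_{i,t}+g_{i,t})$; $(p'_{i,t},r_{i,t})=\mathrm{PSync}(p_{i,t},\mathcal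 C_2)$; $x_{i,t-\frac12}=x_{i,t-1}-p'_{i,t}$; $e_{i,t-\frac12}=e_{i,t-1}-r_{i,t}$. If $H\nmid t$: $x_{i,t}=x_{i,t-\frac12}$, $e_{i,t}=e_{i,t-\frac12}$. If $H\mid t$: $(e'_{i,t-\frac12},e_{i,t})=\mathrm{PSync}(e_{i,t-\frac12},\mathcal C_1)$ and $x_{i,t}=x_{i,t-\frac12}-e_{i,t-\frac12}+e'_{i,t-\frac12}$. Smoothness assumption: each $F_i$, $i\in[n]$, is $L$-smooth, meaning $F_i(y)-F_i(x)\le\langle\nabla F_i(x),y-x\rangle+\frac L2\|y-x\|^2$ for all $x,y$. Gradient assumption: for every stochastic gradient $g_{i,t}=\nabla f(x_{i,t-1};z_{i,t})$, $z_{i,t}\sim\mathcal D_i$, one has $\mathbb E[\|g_{i,t}-\nabla F_i(x_{i,t-1})\|^2]\le V_1$ and $\|\mathbb E[g_{i,t}]\|^2\le V_1'$ for all $i\in[n]$, $t\in[T]$; furthermore, gradients from different workers are independent of each other. (The bound $\mathbb E[\|g_{i,t}\|^2]\le V_2:=V_1+V_1'$ is noted as a consequence.) Global minimum assumption: there exists at least one $x_*$ with $F(x_* )\le F(x)$ for all $x$.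
   Formalization: L-smoothness is taken two-sided (Lipschitz gradients), stochastic gradients are assumed unbiased, and the first bound is stated when the minimum defining η is attained by its first argument; without these the stated bound fails. ‖E[g]‖² ≤ V1' is read given the current iterate, almost surely. *)

theory Defs
  imports "HOL-Probability.Probability"
begin

definition grad :: "('a::real_inner \<Rightarrow> real) \<Rightarrow> 'a \<Rightarrow> 'a" where
  "grad h x = (THE d. GDERIV h x :> d)"

text \<open>The quadratic bound is two-sided, so that for a differentiable function it amounts to
  Lipschitz continuity of the gradient with constant \<open>L\<close>. The upper bound alone holds for every
  differentiable concave function.\<close>

definition L_smooth :: "real \<Rightarrow> ('a::real_inner \<Rightarrow> real) \<Rightarrow> bool" where
  "L_smooth L h \<longleftrightarrow>
     (\<forall>x. \<exists>d. GDERIV h x :> d) \<and>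
     (\<forall>x y. \<bar>h y - h x - inner (grad h x) (y - x)\<bar> \<le> L / 2 * (norm (y - x))\<^sup>2)"

definition approx_compressor :: "real \<Rightarrow> ('a::real_normed_vector \<Rightarrow> 'a) \<Rightarrow> bool" where
  "approx_compressor \<delta> C \<longleftrightarrow>
     0 \<le> \<delta> \<and> \<delta> \<le> 1 \<and> (\<forall>v. (norm (C v - v))\<^sup>2 \<le> (1 - \<delta>) * (norm v)\<^sup>2)"

text \<open>Workers are numbered \<open>1, \<dots>, n\<close>; \<open>D i\<close> is the data distribution of worker \<open>i\<close>.\<close>

definition local_obj :: "(nat \<Rightarrow> 'z measure) \<Rightarrow> ('a \<Rightarrow> 'z \<Rightarrow> real) \<Rightarrow> nat \<Rightarrow> 'a \<Rightarrow> real" where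
  "local_obj D f i x = (\<integral>z. f x z \<partial>D i)"

definition global_obj :: "nat \<Rightarrow> (nat \<Rightarrow> 'z measure) \<Rightarrow> ('a \<Rightarrow> 'z \<Rightarrow> real) \<Rightarrow> 'a \<Rightarrow> real" where
  "global_obj n D f x = (1 / real n) * (\<Sum>i\<in>{1..n}. local_obj D f i x)"

definition stoch_grad :: "('a::real_inner \<Rightarrow> 'z \<Rightarrow> real) \<Rightarrow> 'a \<Rightarrow> 'z \<Rightarrow> 'a" where
  "stoch_grad f x z = grad (\<lambda>y. f y z) x"

text \<open>The last conjunct is the identity \<open>\<nabla>F\<^sub>i(x) = E \<nabla>f(x; z)\<close>, i.e. that stochastic gradients are
  unbiased. It does not follow from differentiability and integrability alone.\<close>

definition stochastic_problem ::
  "nat \<Rightarrow> (nat \<Rightarrow> 'z measure) \<Rightarrow> ('a::euclidean_space \<Rightarrow> 'z \<Rightarrow> real) \<Rightarrow> bool" where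
  "stochastic_problem n D f \<longleftrightarrow>
     0 < n \<and> inj_on D {1..n} \<and>
     (\<forall>i\<in>{1..n}.
        prob_space (D i) \<and>
        (\<forall>x. integrable (D i) (f x)) \<and>
        (\<forall>z\<in>space (D i). \<forall>x. \<exists>d. GDERIV (\<lambda>y. f y z) x :> d) \<and>
        (\<forall>x. integrable (D i) (stoch_grad f x) \<and>
             GDERIV (local_obj D f i) x :> (\<integral>z. stoch_grad f x z \<partial>D i)))"

definition psync ::
  "nat \<Rightarrow> ('a::real_vector \<Rightarrow> 'a) \<Rightarrow> (nat \<Rightarrow> 'a) \<Rightarrow> nat \<Rightarrow> 'a \<times> 'a" where
  "psync n C v i =
     (let r = v i - C (v i)
      in ((1 / real n) *\<^sub>R (\<Sum>k\<in>{1..n}. C (v k)) + r, r))"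

text \<open>The triple \<open>(x\<^sub>i\<^sub>,\<^sub>t, e\<^sub>i\<^sub>,\<^sub>t, m\<^sub>i\<^sub>,\<^sub>t)\<close>, as functions of the worker \<open>i\<close>, after \<open>t\<close> iterations on the
  sample path \<open>\<zeta> i t = z\<^sub>i\<^sub>,\<^sub>t\<close>.\<close>

primrec mcser ::
  "nat \<Rightarrow> nat \<Rightarrow> real \<Rightarrow> real \<Rightarrow> ('a \<Rightarrow> 'a) \<Rightarrow> ('a \<Rightarrow> 'a) \<Rightarrow> ('a::euclidean_space \<Rightarrow> 'z \<Rightarrow> real) \<Rightarrow> 'a
   \<Rightarrow> (nat \<Rightarrow> nat \<Rightarrow> 'z) \<Rightarrow> nat \<Rightarrow> (nat \<Rightarrow> 'a) \<times> (nat \<Rightarrow> 'a) \<times> (nat \<Rightarrow> 'a)" where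
  "mcser n H \<beta> \<eta> C1 C2 f x0 \<zeta> 0 = (\<lambda>i. x0, \<lambda>i. 0, \<lambda>i. 0)"
| "mcser n H \<beta> \<eta> C1 C2 f x0 \<zeta> (Suc t) =
     (let (x, e, m) = mcser n H \<beta> \<eta> C1 C2 f x0 \<zeta> t;
          g = (\<lambda>i. stoch_grad f (x i) (\<zeta> i (Suc t)));
          m' = (\<lambda>i. \<beta> *\<^sub>R m i + g i);
          p = (\<lambda>i. \<eta> *\<^sub>R (\<beta> *\<^sub>R m' i + g i));
          xh = (\<lambda>i. x i - fst (psync n C2 p i));
          eh = (\<lambda>i. e i - snd (psync n C2 p i))
      in if H dvd Suc t
         then (\<lambda>i. xh i - eh i + fst (psync n C1 eh i), \<lambda>i. snd (psync n C1 eh i), m')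
         else (xh, eh, m'))"

text \<open>The same iterates as random variables, driven by random samples \<open>Z i t\<close>.\<close>

definition mcser_x ::
  "nat \<Rightarrow> nat \<Rightarrow> real \<Rightarrow> real \<Rightarrow> ('a \<Rightarrow> 'a) \<Rightarrow> ('a \<Rightarrow> 'a) \<Rightarrow> ('a::euclidean_space \<Rightarrow> 'z \<Rightarrow> real) \<Rightarrow> 'a
   \<Rightarrow> (nat \<Rightarrow> nat \<Rightarrow> 'w \<Rightarrow> 'z) \<Rightarrow> nat \<Rightarrow> nat \<Rightarrow> 'w \<Rightarrow> 'a" where
  "mcser_x n H \<beta> \<eta> C1 C2 f x0 Z i t \<omega> =
     fst (mcser n H \<beta> \<eta> C1 C2 f x0 (\<lambda>k s. Z k s \<omega>) t) i"

definition mcser_mean ::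
  "nat \<Rightarrow> nat \<Rightarrow> real \<Rightarrow> real \<Rightarrow> ('a \<Rightarrow> 'a) \<Rightarrow> ('a \<Rightarrow> 'a) \<Rightarrow> ('a::euclidean_space \<Rightarrow> 'z \<Rightarrow> real) \<Rightarrow> 'a
   \<Rightarrow> (nat \<Rightarrow> nat \<Rightarrow> 'w \<Rightarrow> 'z) \<Rightarrow> nat \<Rightarrow> 'w \<Rightarrow> 'a" where
  "mcser_mean n H \<beta> \<eta> C1 C2 f x0 Z t \<omega> =
     (1 / real n) *\<^sub>R (\<Sum>i\<in>{1..n}. mcser_x n H \<beta> \<eta> C1 C2 f x0 Z i t \<omega>)"

text \<open>Fresh samples: independent across workers as well as across iterations.\<close>

definition mcser_sampling ::
  "'w measure \<Rightarrow> nat \<Rightarrow> nat \<Rightarrow> (nat \<Rightarrow> 'z measure) \<Rightarrow> (nat \<Rightarrow> nat \<Rightarrow> 'w \<Rightarrow> 'z) \<Rightarrow> bool" where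
  "mcser_sampling M n T D Z \<longleftrightarrow>
     prob_space M \<and>
     prob_space.indep_vars M (\<lambda>(i, t). D i) (\<lambda>(i, t). Z i t) ({1..n} \<times> {1..T}) \<and>
     (\<forall>i\<in>{1..n}. \<forall>t\<in>{1..T}. distr M (D i) (Z i t) = D i)"

text \<open>Here \<open>X i t\<close> is the iterate \<open>x\<^sub>i\<^sub>,\<^sub>t\<close>. In the bound on \<open>E[g\<^sub>i\<^sub>,\<^sub>t]\<close> the expectation is over the fresh
  sample, with the iterate \<open>x\<^sub>i\<^sub>,\<^sub>t\<^sub>-\<^sub>1\<close> held fixed; only then does it bound the second moment of
  \<open>g\<^sub>i\<^sub>,\<^sub>t\<close> by \<open>V1 + V1'\<close>.\<close>

definition gradient_bounds ::
  "'w measure \<Rightarrow> nat \<Rightarrow> nat \<Rightarrow> (nat \<Rightarrow> 'z measure) \<Rightarrow> ('a::euclidean_space \<Rightarrow> 'z \<Rightarrow> real)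
   \<Rightarrow> (nat \<Rightarrow> nat \<Rightarrow> 'w \<Rightarrow> 'z) \<Rightarrow> (nat \<Rightarrow> nat \<Rightarrow> 'w \<Rightarrow> 'a) \<Rightarrow> real \<Rightarrow> real \<Rightarrow> bool" where
  "gradient_bounds M n T D f Z X V1 V1' \<longleftrightarrow>
     (\<forall>i\<in>{1..n}. \<forall>t\<in>{1..T}.
        (let dev = (\<lambda>\<omega>. (norm (stoch_grad f (X i (t - 1) \<omega>) (Z i t \<omega>)
                               - grad (local_obj D f i) (X i (t - 1) \<omega>)))\<^sup>2)
         in integrable M dev \<and> (\<integral>\<omega>. dev \<omega> \<partial>M) \<le> V1) \<and>
        (AE \<omega> in M. (norm (\<integral>z. stoch_grad f (X i (t - 1) \<omega>) z \<partial>D i))\<^sup>2 \<le> V1'))"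

text \<open>All assumptions on a run of \<open>T\<close> iterations with step size \<open>\<eta>\<close>. Measurability of the
  compressors is what makes the iterates random variables.\<close>

definition mcser_assumptions ::
  "real \<Rightarrow> real \<Rightarrow> real \<Rightarrow> real \<Rightarrow> real \<Rightarrow> nat \<Rightarrow> real \<Rightarrow> real \<Rightarrow> nat \<Rightarrow> nat
   \<Rightarrow> ('a \<Rightarrow> 'a) \<Rightarrow> ('a \<Rightarrow> 'a) \<Rightarrow> 'w measure \<Rightarrow> (nat \<Rightarrow> 'z measure)
   \<Rightarrow> ('a::euclidean_space \<Rightarrow> 'z \<Rightarrow> real) \<Rightarrow> (nat \<Rightarrow> nat \<Rightarrow> 'w \<Rightarrow> 'z) \<Rightarrow> 'a \<Rightarrow> 'a \<Rightarrow> bool" where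
  "mcser_assumptions L V1 V1' \<delta>1 \<delta>2 H \<beta> \<eta> n T C1 C2 M D f Z x0 xstar \<longleftrightarrow>
     approx_compressor \<delta>1 C1 \<and> C1 \<in> borel_measurable borel \<and>
     approx_compressor \<delta>2 C2 \<and> C2 \<in> borel_measurable borel \<and>
     stochastic_problem n D f \<and>
     (\<forall>i\<in>{1..n}. L_smooth L (local_obj D f i)) \<and>
     (\<forall>x. global_obj n D f xstar \<le> global_obj n D f x) \<and>
     mcser_sampling M n T D Z \<and>
     gradient_bounds M n T D f Z (mcser_x n H \<beta> \<eta> C1 C2 f x0 Z) V1 V1'"

text \<open>\<open>step_size\<close> is the step size of the method; \<open>uncapped_step\<close> is the first argument of the
  minimum. The bounds at a fixed \<open>T\<close> need the minimum to be attained there: where it is the cap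
  \<open>1 / 2\<close>, iterates may move too slowly for a large \<open>\<gamma>\<close>.\<close>

definition error_const :: "real \<Rightarrow> real \<Rightarrow> nat \<Rightarrow> real" where
  "error_const \<delta>1 \<delta>2 H =
     2 * (4 * (1 - \<delta>1) / \<delta>1\<^sup>2 + 1) * (1 - \<delta>2) * (real H)\<^sup>2 + 1"

definition uncapped_step :: "real \<Rightarrow> real \<Rightarrow> nat \<Rightarrow> nat \<Rightarrow> real" where
  "uncapped_step \<gamma> A n T =
     \<gamma> / (sqrt (real T / real n) + A powr (1 / 3) * real T powr (1 / 3))"

definition step_size :: "real \<Rightarrow> real \<Rightarrow> nat \<Rightarrow> nat \<Rightarrow> real" where
  "step_size \<gamma> A n T = min (uncapped_step \<gamma> A n T) (1 / 2)"

end

theory Submission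
  imports Defs
begin

text \<open>Write \<open>x\<^sub>t\<close> and \<open>m\<^sub>t\<close> for the averages over the workers of the models and momenta, and
  \<open>a = \<eta> / (1 - \<beta>)\<close>. Synchronization preserves averages, so
  \<open>y\<^sub>t = x\<^sub>t - (\<eta> \<beta>\<^sup>2 / (1 - \<beta>)) m\<^sub>t\<close> performs stochastic gradient descent with step size \<open>a\<close>, and
  the noise of different workers is orthogonal in mean square. In the descent inequality at \<open>y\<^sub>t\<close>
  the gradient has to be compared with the mean \<open>G\<close> of the local gradients. The distance of the
  local models from \<open>x\<^sub>t\<close> is that of the local errors from their average, whose second moments are
  controlled by a contraction at each synchronization; the distance of \<open>y\<^sub>t\<close> from \<open>x\<^sub>t\<close> is
  controlled by the second moment of the momentum.

  The constants leave no room for the factor 2 that the usual splitting of the inner product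
  loses on the momentum term. If \<open>\<beta>\<^sup>4 \<le> 1 - L a\<close>, the weight \<open>(1 - L a) / 2\<close> of \<open>\<parallel>G\<parallel>\<^sup>2\<close> suffices to
  absorb this term. Otherwise \<open>L a \<ge> 2 (1 - \<beta>)\<close>, and the claimed bound exceeds the
  second moment of the gradient.\<close>

section \<open>Smooth functions and stochastic gradients\<close>

text \<open>The constant \<open>A\<close> of the step size is used as \<open>(A - 1) + 1\<close>:
  the local errors contribute at most \<open>A - 1\<close> multiples of \<open>drift\<close> to the
  descent inequality, and exactly one multiple is left for the momentum shift. To stay within this
  budget, the errors accumulated between two synchronizations are added as mean-square norms by
  Minkowski's inequality; expanding a square at every step would bring in constants that
  \<open>A\<close> does not contain.

  Orthogonality of the noise is proved without conditional expectations. The samples are split into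
  a single fresh one and all the others, these two parts are independent, and Fubini's theorem
  integrates over the fresh one first. For this the iterates must be measurable functions on a
  product space of samples, hence \<open>stoch_grad f\<close> jointly measurable in point and
  sample. The assumptions give \<open>f\<close> measurable only in the sample, so joint
  measurability is derived first for \<open>f\<close> and then, through difference quotients, for
  its gradient.

  The lower bound on \<open>T\<close> enters only as
  \<open>L * \<eta> / (1 - \<beta>) \<le> 1 / 2\<close>.\<close>

lemma GDERIV_unique:
  assumes "GDERIV h x :> d" "GDERIV h x :> d'"
  shows "d = d'"
proof -
  have "(\<lambda>k. inner k d) = (\<lambda>k. inner k d')"
    using assms has_derivative_unique unfolding gderiv_def by blast
  then have "inner (d - d') d = inner (d - d') d'"
    by metis
  then have "inner (d - d') (d - d') = 0"
    by (simp add: inner_diff_right)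
  then show ?thesis
    by simp
qed

lemma grad_eq: "GDERIV h x :> d \<Longrightarrow> grad h x = d"
  unfolding grad_def by (blast intro: GDERIV_unique)

lemma GDERIV_sum:
  assumes "\<And>i. i \<in> S \<Longrightarrow> GDERIV (h i) x :> d i"
  shows "GDERIV (\<lambda>y. \<Sum>i\<in>S. h i y) x :> (\<Sum>i\<in>S. d i)"
  using assms unfolding gderiv_def inner_sum_right by (rule has_derivative_sum)

lemma GDERIV_cmult:
  assumes "GDERIV h x :> d"
  shows "GDERIV (\<lambda>y. c * h y) x :> c *\<^sub>R d"
  using assms unfolding gderiv_def inner_scaleR_right by (rule has_derivative_mult_right)

lemma L_smooth_GDERIV: "L_smooth L h \<Longrightarrow> GDERIV h x :> grad h x"
  unfolding L_smooth_def by (metis grad_eq)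

lemma L_smooth_abs_le:
  "L_smooth L h \<Longrightarrow> \<bar>h y - h x - inner (grad h x) (y - x)\<bar> \<le> L / 2 * (norm (y - x))\<^sup>2"
  unfolding L_smooth_def by blast

lemma L_smooth_nonneg:
  fixes h :: "'a::euclidean_space \<Rightarrow> real"
  assumes "L_smooth L h"
  shows "0 \<le> L"
proof -
  \<comment> \<open>The quadratic bound has to be tested at a nonzero displacement; a Euclidean
    space has one because its basis is nonempty.\<close>
  obtain b :: 'a where "b \<in> Basis"
    using nonempty_Basis by blast
  then have "0 \<le> L / 2 * (norm b)\<^sup>2"
    using L_smooth_abs_le [OF assms, of b 0] by (smt (verit) diff_zero)
  then show ?thesis
    using \<open>b \<in> Basis\<close> by simp
qed

text \<open>The upper bound at one point and the lower bound at the other are compared at two trial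
  points symmetric about the midpoint of \<open>x\<close> and \<open>y\<close>.\<close>

lemma L_smooth_Lipschitz:
  fixes h :: "'a::euclidean_space \<Rightarrow> real"
  assumes "L_smooth L h"
  shows "norm (grad h y - grad h x) \<le> L * norm (y - x)"
proof (cases "grad h y = grad h x")
  case True
  then show ?thesis
    using L_smooth_nonneg [OF assms] by simp
next
  case False
  define G where "G = grad h y - grad h x"
  have G: "norm G > 0"
    using False by (simp add: G_def)
  define d where "d = (1/2) *\<^sub>R (y - x)"
  \<comment> \<open>\<open>k\<close> points against the gradient difference \<open>G\<close>, so
    that \<open>- inner G k\<close> is as large as possible for its length. The length
    \<open>norm d\<close> is the best one: with \<open>s * norm d\<close> the same argument gives
    \<open>norm G \<le> (s + 1 / s) * L * norm d\<close>, and \<open>s = 1\<close> yields exactly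
    the constant \<open>L\<close>.\<close>
  define k where "k = - (norm d / norm G) *\<^sub>R G"
  define p where "p = x + d + k"
  define q where "q = x + d - k"
  have y: "y = x + d + d"
    by (simp add: d_def add.assoc flip: scaleR_add_left)
  have nk: "norm k = norm d"
    using G by (simp add: k_def)
  have eqs: "p - x = d + k" "p - y = k - d" "q - x = d - k" "q - y = - (d + k)"
    by (simp_all add: p_def q_def y)
  have "h p \<le> h y + inner (grad h y) (p - y) + L / 2 * (norm (p - y))\<^sup>2"
    "h p \<ge> h x + inner (grad h x) (p - x) - L / 2 * (norm (p - x))\<^sup>2"
    "h q \<le> h x + inner (grad h x) (q - x) + L / 2 * (norm (q - x))\<^sup>2"
    "h q \<ge> h y + inner (grad h y) (q - y) - L / 2 * (norm (q - y))\<^sup>2"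
    using L_smooth_abs_le [OF assms, of p y] L_smooth_abs_le [OF assms, of p x]
      L_smooth_abs_le [OF assms, of q x] L_smooth_abs_le [OF assms, of q y]
    by linarith+
  then have "inner (grad h x) (p - x) + inner (grad h y) (q - y)
      - inner (grad h y) (p - y) - inner (grad h x) (q - x)
      \<le> L / 2 * ((norm (p - x))\<^sup>2 + (norm (p - y))\<^sup>2 + (norm (q - x))\<^sup>2 + (norm (q - y))\<^sup>2)"
    by (simp add: algebra_simps)
  also have "\<dots> = L / 2 * (4 * ((norm d)\<^sup>2 + (norm k)\<^sup>2))"
    unfolding eqs power2_norm_eq_inner
    by (simp add: inner_diff_left inner_diff_right inner_add_left inner_add_right inner_commute
        algebra_simps)
  also have "\<dots> = 4 * L * (norm d)\<^sup>2"
    by (simp add: nk)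
  also have "inner (grad h x) (p - x) + inner (grad h y) (q - y)
      - inner (grad h y) (p - y) - inner (grad h x) (q - x) = - 2 * inner G k"
    unfolding eqs G_def by (simp add: inner_diff_left inner_diff_right inner_add_right)
  also have "\<dots> = 2 * norm d * norm G"
    using G by (simp add: k_def power2_norm_eq_inner [symmetric] power2_eq_square)
  finally have *: "norm d * norm G \<le> norm d * (2 * L * norm d)"
    by (simp add: power2_eq_square mult_ac)
  show ?thesis
  proof (cases "norm d = 0")
    case True
    then have "y = x"
      by (simp add: y)
    with False show ?thesis
      by simp
  next
    case False
    with * have "norm G \<le> 2 * L * norm d"
      by (metis mult_le_cancel_left_pos norm_ge_zero order_le_less)
    then show ?thesis
      by (simp add: G_def d_def)
  qed
qed

lemma L_smooth_grad_continuous: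
  fixes h :: "'a::euclidean_space \<Rightarrow> real"
  assumes "L_smooth L h"
  shows "continuous_on UNIV (grad h)"
proof -
  have "L-lipschitz_on UNIV (grad h)"
    using L_smooth_Lipschitz [OF assms] L_smooth_nonneg [OF assms]
    by (auto simp: lipschitz_on_def dist_norm)
  then show ?thesis
    by (rule lipschitz_on_continuous_on)
qed

lemma L_smooth_continuous:
  fixes h :: "'a::euclidean_space \<Rightarrow> real"
  assumes "L_smooth L h"
  shows "continuous_on UNIV h"
  using L_smooth_GDERIV [OF assms] unfolding gderiv_def
  by (metis continuous_at_imp_continuous_on has_derivative_continuous)

lemma
  assumes "\<And>i. i \<in> {1..n} \<Longrightarrow> L_smooth L (h i)" "0 < n"
  shows grad_average:
      "grad (\<lambda>y. (1 / real n) * (\<Sum>i\<in>{1..n}. h i y)) x = (1 / real n) *\<^sub>R (\<Sum>i\<in>{1..n}. grad (h i) x)"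
    and L_smooth_average: "L_smooth L (\<lambda>y. (1 / real n) * (\<Sum>i\<in>{1..n}. h i y))"
proof -
  let ?F = "\<lambda>y. (1 / real n) * (\<Sum>i\<in>{1..n}. h i y)"
  have der: "GDERIV ?F x :> (1 / real n) *\<^sub>R (\<Sum>i\<in>{1..n}. grad (h i) x)" for x
    by (intro GDERIV_cmult GDERIV_sum L_smooth_GDERIV [where L = L] assms(1))
  show gr: "grad ?F x = (1 / real n) *\<^sub>R (\<Sum>i\<in>{1..n}. grad (h i) x)" for x
    by (rule grad_eq [OF der])
  have "\<bar>?F y - ?F x - inner (grad ?F x) (y - x)\<bar> \<le> L / 2 * (norm (y - x))\<^sup>2" for x y
  proof -
    have "?F y - ?F x - inner (grad ?F x) (y - x)
        = (1 / real n) * (\<Sum>i\<in>{1..n}. h i y - h i x - inner (grad (h i) x) (y - x))"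
      unfolding gr by (simp add: inner_sum_left sum_subtractf diff_divide_distrib)
    also have "\<bar>\<dots>\<bar> \<le> (1 / real n) * (\<Sum>i\<in>{1..n}. L / 2 * (norm (y - x))\<^sup>2)"
      unfolding abs_mult
      by (intro mult_mono order_trans [OF sum_abs] sum_mono L_smooth_abs_le assms) auto
    finally show ?thesis
      using \<open>0 < n\<close> by simp
  qed
  then show "L_smooth L ?F"
    using der unfolding L_smooth_def by blast
qed

text \<open>Young's inequality: the gap between the two sides is \<open>r\<close> times the squared
  norm of \<open>a - (1 / r) *\<^sub>R b\<close>. The weight \<open>r\<close> is left free so that
  it can be optimized in the proof of Minkowski's inequality.\<close>

lemma norm_sq_add_le_weighted:
  fixes a b :: "'a::real_inner"
  assumes "0 < r"
  shows "(norm (a + b))\<^sup>2 \<le> (1 + r) * (norm a)\<^sup>2 + (1 + 1 / r) * (norm b)\<^sup>2"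
proof -
  have "0 \<le> r * (norm (a - (1 / r) *\<^sub>R b))\<^sup>2"
    using assms by simp
  also have "\<dots> = r * (norm a)\<^sup>2 + 1 / r * (norm b)\<^sup>2 - 2 * inner a b"
    using assms unfolding power2_norm_eq_inner
    by (simp add: inner_diff_left inner_diff_right inner_commute field_simps)
  finally show ?thesis
    by (simp add: power2_norm_eq_inner inner_add_left inner_add_right inner_commute algebra_simps)
qed

text \<open>Convexity of the squared norm with weights \<open>\<beta>\<close> and
  \<open>1 - \<beta>\<close> at the points \<open>m\<close> and \<open>g / (1 - \<beta>)\<close>. In
  this form the momentum recursion becomes a scalar recursion with factor
  \<open>\<beta>\<close>.\<close>

lemma norm_sq_convex_le:
  fixes m g :: "'a::real_inner"
  assumes "0 \<le> \<beta>" "\<beta> < 1"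
  shows "(norm (\<beta> *\<^sub>R m + g))\<^sup>2 \<le> \<beta> * (norm m)\<^sup>2 + (norm g)\<^sup>2 / (1 - \<beta>)"
proof -
  have "0 \<le> \<beta> / (1 - \<beta>) * (norm ((1 - \<beta>) *\<^sub>R m - g))\<^sup>2"
    using assms by simp
  also have "\<dots> = \<beta> * (norm m)\<^sup>2 + (norm g)\<^sup>2 / (1 - \<beta>) - (norm (\<beta> *\<^sub>R m + g))\<^sup>2"
    using assms unfolding power2_norm_eq_inner
    by (simp add: inner_diff_left inner_diff_right inner_add_left inner_add_right inner_commute
        divide_simps) (simp add: algebra_simps)
  finally show ?thesis
    by simp
qed

text \<open>The variance decomposition. Nonnegativity of the left side gives Jensen's inequality for
  averages; dropping the last term bounds deviations from the average by the vectors themselves with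
  constant 1.\<close>

lemma sum_norm_sq_deviation:
  fixes v :: "nat \<Rightarrow> 'a::real_inner"
  assumes "0 < n"
  defines "c \<equiv> (1 / real n) *\<^sub>R (\<Sum>i\<in>{1..n}. v i)"
  shows "(\<Sum>i\<in>{1..n}. (norm (v i - c))\<^sup>2) = (\<Sum>i\<in>{1..n}. (norm (v i))\<^sup>2) - real n * (norm c)\<^sup>2"
proof -
  have s: "(\<Sum>i\<in>{1..n}. v i) = real n *\<^sub>R c"
    using assms by simp
  have "(\<Sum>i\<in>{1..n}. (norm (v i - c))\<^sup>2)
      = (\<Sum>i\<in>{1..n}. (norm (v i))\<^sup>2 - 2 * inner (v i) c + (norm c)\<^sup>2)"
    by (intro sum.cong refl)
      (simp add: power2_norm_eq_inner inner_diff_left inner_diff_right inner_commute)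
  also have "\<dots> = (\<Sum>i\<in>{1..n}. (norm (v i))\<^sup>2) - 2 * inner (\<Sum>i\<in>{1..n}. v i) c + real n * (norm c)\<^sup>2"
    by (simp add: sum.distrib sum_subtractf inner_sum_left sum_distrib_left)
  finally show ?thesis
    unfolding s by (simp add: power2_norm_eq_inner)
qed

lemma norm_sq_average_le:
  fixes v :: "nat \<Rightarrow> 'a::real_inner"
  shows "(norm ((1 / real n) *\<^sub>R (\<Sum>i\<in>{1..n}. v i)))\<^sup>2 \<le> (1 / real n) * (\<Sum>i\<in>{1..n}. (norm (v i))\<^sup>2)"
proof (cases "n = 0")
  case False
  then have "0 \<le> (\<Sum>i\<in>{1..n}. (norm (v i))\<^sup>2) - real n * (norm ((1 / real n) *\<^sub>R (\<Sum>i\<in>{1..n}. v i)))\<^sup>2"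
    by (subst sum_norm_sq_deviation [symmetric]) (auto intro: sum_nonneg)
  with False show ?thesis
    by (simp add: field_simps)
qed simp

text \<open>The value \<open>f x z\<close> is the limit of \<open>f (r\<^sub>k x) z\<close>, where
  \<open>r\<^sub>k x\<close> is a nearby point of a countable dense set.\<close>

lemma borel_measurable_Caratheodory:
  fixes f :: "'a::{second_countable_topology, metric_space} \<Rightarrow> 'z \<Rightarrow> 'b::metric_space"
  assumes meas: "\<And>x. f x \<in> borel_measurable D"
    and cont: "\<And>z. z \<in> space D \<Longrightarrow> continuous_on UNIV (\<lambda>x. f x z)"
  shows "(\<lambda>(x, z). f x z) \<in> borel_measurable (borel \<Otimes>\<^sub>M D)"
proof -
  obtain S :: "'a set" where S: "countable S" "\<And>U. open U \<Longrightarrow> U \<noteq> {} \<Longrightarrow> \<exists>y\<in>S. y \<in> U"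
    using countable_dense_setE by blast
  have "S \<noteq> {}"
    using S(2) [of UNIV] by auto
  define d where "d = from_nat_into S"
  \<comment> \<open>\<open>r k x\<close> is the least index of a dense point within
    \<open>1 / Suc k\<close> of \<open>x\<close>. Choosing the least index makes \<open>r k\<close>
    measurable with values in \<open>nat\<close>, so \<open>f (d (r k x)) z\<close> is glued from
    countably many measurable slices.\<close>
  define r where "r k x = (LEAST j. dist x (d j) < 1 / real (Suc k))" for k x
  have ex: "\<exists>j. dist x (d j) < 1 / real (Suc k)" for x k
  proof -
    have "ball x (1 / real (Suc k)) \<noteq> {}"
      by (simp add: ball_eq_empty)
    then obtain y where "y \<in> S" "y \<in> ball x (1 / real (Suc k))"
      using S(2) [OF open_ball] by blast
    moreover from \<open>y \<in> S\<close> obtain j where "y = d j"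
      unfolding d_def using S(1) by (metis from_nat_into_to_nat_on)
    ultimately show ?thesis
      by auto
  qed
  have r: "dist x (d (r k x)) < 1 / real (Suc k)" for x k
    unfolding r_def using ex by (rule LeastI_ex)
  have [measurable]: "r k \<in> measurable borel (count_space UNIV)" for k
    unfolding r_def by measurable
  note [measurable] = meas
  have lim: "(\<lambda>k. d (r k x)) \<longlonglongrightarrow> x" for x
  proof (rule metric_tendsto_imp_tendsto [of "\<lambda>k. 1 / real (Suc k)" 0])
    show "(\<lambda>k. 1 / real (Suc k)) \<longlonglongrightarrow> 0"
      by (rule LIMSEQ_Suc) (rule lim_1_over_n)
    show "\<forall>\<^sub>F k in sequentially. dist (d (r k x)) x \<le> dist (1 / real (Suc k)) 0"
      using r by (auto simp: dist_commute less_imp_le)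
  qed
  show ?thesis
  proof (rule borel_measurable_LIMSEQ_metric)
    show "(\<lambda>p. f (d (r k (fst p))) (snd p)) \<in> borel_measurable (borel \<Otimes>\<^sub>M D)" for k
      by (rule measurable_compose_countable [where f = "\<lambda>j p. f (d j) (snd p)"
            and g = "\<lambda>p. r k (fst p)"]) measurable
    show "(\<lambda>k. f (d (r k (fst p))) (snd p)) \<longlonglongrightarrow> (case p of (x, z) \<Rightarrow> f x z)"
      if "p \<in> space (borel \<Otimes>\<^sub>M D)" for p
    proof -
      have "snd p \<in> space D"
        using that by (auto simp: space_pair_measure)
      then have "isCont (\<lambda>x. f x (snd p)) (fst p)"
        using cont by (auto simp: continuous_on_eq_continuous_at)
      then show ?thesis
        using isCont_tendsto_compose [OF _ lim] by (auto simp: split_beta)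
    qed
  qed
qed

lemma GDERIV_difference_quotient:
  assumes "GDERIV h x :> d"
  shows "(\<lambda>k. real (Suc k) * (h (x + (1 / real (Suc k)) *\<^sub>R b) - h x)) \<longlonglongrightarrow> inner b d"
proof -
  have "((\<lambda>s. h (x + s *\<^sub>R b)) has_derivative (\<lambda>s. inner (s *\<^sub>R b) d)) (at 0)"
    by (rule has_derivative_compose [where f = "\<lambda>s. x + s *\<^sub>R b" and f' = "\<lambda>s. s *\<^sub>R b"])
      (use assms in \<open>auto simp: gderiv_def intro!: derivative_eq_intros\<close>)
  then have "((\<lambda>s. h (x + s *\<^sub>R b)) has_field_derivative inner b d) (at 0)"
    by (simp add: has_field_derivative_def mult.commute [of _ "inner b d"])
  then have *: "((\<lambda>s. (h (x + s *\<^sub>R b) - h x) / s) \<longlongrightarrow> inner b d) (at 0)"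
    by (simp add: DERIV_def)
  have "filterlim (\<lambda>k. 1 / real (Suc k)) (at 0) sequentially"
    unfolding filterlim_at using LIMSEQ_Suc [OF lim_1_over_n] by auto
  from filterlim_compose [OF * this] show ?thesis
    by (simp add: mult.commute)
qed

text \<open>The gradient is not assumed continuous in \<open>x\<close>, so the argument used for
  \<open>f\<close> cannot be repeated for it. Instead each coordinate is a pointwise limit of
  difference quotients of \<open>f\<close>, and these are jointly measurable.\<close>

lemma borel_measurable_stoch_grad:
  fixes f :: "'a::euclidean_space \<Rightarrow> 'z \<Rightarrow> real"
  assumes meas: "\<And>x. f x \<in> borel_measurable D"
    and diff: "\<And>z x. z \<in> space D \<Longrightarrow> \<exists>d. GDERIV (\<lambda>y. f y z) x :> d"
  shows "(\<lambda>(x, z). stoch_grad f x z) \<in> borel_measurable (borel \<Otimes>\<^sub>M D)"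
proof -
  have der: "GDERIV (\<lambda>y. f y z) x :> stoch_grad f x z" if "z \<in> space D" for x z
    using diff [OF that, of x] unfolding stoch_grad_def by (metis grad_eq)
  have f [measurable]: "(\<lambda>(x, z). f x z) \<in> borel_measurable (borel \<Otimes>\<^sub>M D)"
  proof (rule borel_measurable_Caratheodory [OF meas])
    show "continuous_on UNIV (\<lambda>x. f x z)" if "z \<in> space D" for z
      using der [OF that] unfolding gderiv_def
      by (metis continuous_at_imp_continuous_on has_derivative_continuous)
  qed
  show ?thesis
    unfolding borel_measurable_euclidean_space [of "\<lambda>(x, z). stoch_grad f x z"]
  proof
    fix b :: 'a assume "b \<in> Basis"
    show "(\<lambda>p. (case p of (x, z) \<Rightarrow> stoch_grad f x z) \<bullet> b) \<in> borel_measurable (borel \<Otimes>\<^sub>M D)"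
    proof (rule borel_measurable_LIMSEQ_real)
      let ?q = "\<lambda>k p. real (Suc k) * (f (fst p + (1 / real (Suc k)) *\<^sub>R b) (snd p) - f (fst p) (snd p))"
      show "?q k \<in> borel_measurable (borel \<Otimes>\<^sub>M D)" for k
        by measurable
      show "(\<lambda>k. ?q k p) \<longlonglongrightarrow> (case p of (x, z) \<Rightarrow> stoch_grad f x z) \<bullet> b"
        if "p \<in> space (borel \<Otimes>\<^sub>M D)" for p
      proof -
        have "snd p \<in> space D"
          using that by (auto simp: space_pair_measure)
        from GDERIV_difference_quotient [OF der [OF this], of "fst p" b] show ?thesis
          by (auto simp: inner_commute split_beta)
      qed
    qed
  qed
qed

section \<open>Square-integrable random vectors\<close>

text \<open>Measurability is a separate clause because integrability of the squared norm controls
  only the norm of \<open>u\<close>.\<close>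

definition sq_integrable :: "'w measure \<Rightarrow> ('w \<Rightarrow> 'a::euclidean_space) \<Rightarrow> bool" where
  "sq_integrable M u \<longleftrightarrow> u \<in> borel_measurable M \<and> integrable M (\<lambda>\<omega>. (norm (u \<omega>))\<^sup>2)"

lemma sq_integrable_measurable [measurable_dest]: "sq_integrable M u \<Longrightarrow> u \<in> borel_measurable M"
  and sq_integrable_integrable: "sq_integrable M u \<Longrightarrow> integrable M (\<lambda>\<omega>. (norm (u \<omega>))\<^sup>2)"
  by (simp_all add: sq_integrable_def)

lemma sq_integrable_dominated:
  assumes "u \<in> borel_measurable M" "integrable M b" "AE \<omega> in M. (norm (u \<omega>))\<^sup>2 \<le> b \<omega>"
  shows "sq_integrable M u"
  unfolding sq_integrable_def
proof
  show "integrable M (\<lambda>\<omega>. (norm (u \<omega>))\<^sup>2)"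
    by (rule Bochner_Integration.integrable_bound [OF assms(2)]) (use assms in auto)
qed fact

lemma sq_integrable_add:
  assumes "sq_integrable M u" "sq_integrable M v"
  shows "sq_integrable M (\<lambda>\<omega>. u \<omega> + v \<omega>)"
proof (rule sq_integrable_dominated)
  show "integrable M (\<lambda>\<omega>. 2 * (norm (u \<omega>))\<^sup>2 + 2 * (norm (v \<omega>))\<^sup>2)"
    using assms by (auto simp: sq_integrable_def)
  show "AE \<omega> in M. (norm (u \<omega> + v \<omega>))\<^sup>2 \<le> 2 * (norm (u \<omega>))\<^sup>2 + 2 * (norm (v \<omega>))\<^sup>2"
    using norm_sq_add_le_weighted [of 1] by auto
qed (use assms in \<open>auto simp: sq_integrable_def\<close>)

lemma sq_integrable_scaleR: "sq_integrable M u \<Longrightarrow> sq_integrable M (\<lambda>\<omega>. c *\<^sub>R u \<omega>)"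
  by (auto simp: sq_integrable_def power_mult_distrib)

lemma sq_integrable_diff:
  assumes "sq_integrable M u" "sq_integrable M v"
  shows "sq_integrable M (\<lambda>\<omega>. u \<omega> - v \<omega>)"
  using sq_integrable_add [OF assms(1) sq_integrable_scaleR [OF assms(2), of "-1"]] by simp

lemma sq_integrable_const: "finite_measure M \<Longrightarrow> sq_integrable M (\<lambda>\<omega>. c)"
  by (simp add: sq_integrable_def finite_measure.integrable_const)

lemma sq_integrable_sum:
  assumes "\<And>i. i \<in> S \<Longrightarrow> sq_integrable M (u i)" "finite_measure M"
  shows "sq_integrable M (\<lambda>\<omega>. \<Sum>i\<in>S. u i \<omega>)"
  using assms(1) by (induction S rule: infinite_finite_induct)
    (auto intro!: sq_integrable_add sq_integrable_const assms(2))

lemma integrable_inner_sq_integrable: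
  assumes "sq_integrable M u" "sq_integrable M v"
  shows "integrable M (\<lambda>\<omega>. inner (u \<omega>) (v \<omega>))"
proof (rule Bochner_Integration.integrable_bound)
  show "integrable M (\<lambda>\<omega>. (norm (u \<omega>))\<^sup>2 + (norm (v \<omega>))\<^sup>2)"
    using assms by (auto simp: sq_integrable_def)
  have "\<bar>inner a b\<bar> \<le> (norm a)\<^sup>2 + (norm b)\<^sup>2" for a b :: 'b
  proof -
    have "\<bar>inner a b\<bar> \<le> norm a * norm b"
      by (rule Cauchy_Schwarz_ineq2)
    also have "2 * (norm a * norm b) \<le> (norm a)\<^sup>2 + (norm b)\<^sup>2"
      using sum_squares_bound [of "norm a" "norm b"] by simp
    finally show ?thesis
      by (smt (verit) mult_nonneg_nonneg norm_ge_zero)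
  qed
  then show "AE \<omega> in M. norm (inner (u \<omega>) (v \<omega>)) \<le> norm ((norm (u \<omega>))\<^sup>2 + (norm (v \<omega>))\<^sup>2)"
    by auto
qed (use assms in \<open>auto simp: sq_integrable_def\<close>)

lemma sq_integrable_Lipschitz:
  fixes k :: "'a::euclidean_space \<Rightarrow> 'b::euclidean_space"
  assumes "finite_measure M" "sq_integrable M u"
    and lip: "\<And>x y. norm (k x - k y) \<le> K * norm (x - y)" and k: "continuous_on UNIV k"
  shows "sq_integrable M (\<lambda>\<omega>. k (u \<omega>))"
proof -
  have "sq_integrable M (\<lambda>\<omega>. k (u \<omega>) - k 0)"
  proof (rule sq_integrable_dominated)
    show "integrable M (\<lambda>\<omega>. K\<^sup>2 * (norm (u \<omega>))\<^sup>2)"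
      using assms(2) by (auto simp: sq_integrable_def)
    show "AE \<omega> in M. (norm (k (u \<omega>) - k 0))\<^sup>2 \<le> K\<^sup>2 * (norm (u \<omega>))\<^sup>2"
      using power_mono [OF lip [of _ 0], where n = 2] by (auto simp: power_mult_distrib)
    show "(\<lambda>\<omega>. k (u \<omega>) - k 0) \<in> borel_measurable M"
      using sq_integrable_measurable [OF assms(2)] borel_measurable_continuous_onI [OF k]
      by measurable
  qed
  from sq_integrable_add [OF this sq_integrable_const [OF assms(1), of "k 0"]] show ?thesis
    by simp
qed

text \<open>Minkowski's inequality in mean square, with upper bounds in place of the norms. It comes
  from Young's inequality with the optimal weight, the ratio of the two bounds.\<close>

lemma norm_sq_add_expectation_le:
  assumes u: "sq_integrable M u" "(\<integral>\<omega>. (norm (u \<omega>))\<^sup>2 \<partial>M) \<le> A\<^sup>2" "0 \<le> A"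
    and v: "sq_integrable M v" "(\<integral>\<omega>. (norm (v \<omega>))\<^sup>2 \<partial>M) \<le> B\<^sup>2" "0 \<le> B"
  shows "(\<integral>\<omega>. (norm (u \<omega> + v \<omega>))\<^sup>2 \<partial>M) \<le> (A + B)\<^sup>2"
proof -
  let ?I = "\<integral>\<omega>. (norm (u \<omega> + v \<omega>))\<^sup>2 \<partial>M"
  \<comment> \<open>\<open>A\<close> or \<open>B\<close> may be 0, and then the optimal weight is
    not a positive real. Each is therefore enlarged by \<open>e / 2\<close>, and \<open>e\<close>
    tends to 0 at the end.\<close>
  have "sqrt ?I \<le> (A + B) + e" if "e > 0" for e
  proof -
    define a where "a = A + e / 2"
    define b where "b = B + e / 2"
    have ab: "0 < a" "0 < b" "A \<le> a" "B \<le> b"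
      using that u(3) v(3) by (auto simp: a_def b_def)
    have "?I \<le> (\<integral>\<omega>. (1 + b / a) * (norm (u \<omega>))\<^sup>2 + (1 + 1 / (b / a)) * (norm (v \<omega>))\<^sup>2 \<partial>M)"
      using u(1) v(1) sq_integrable_add [OF u(1) v(1)] ab
      by (intro integral_mono norm_sq_add_le_weighted) (auto simp: sq_integrable_def)
    also have "\<dots> = (1 + b / a) * (\<integral>\<omega>. (norm (u \<omega>))\<^sup>2 \<partial>M) + (1 + 1 / (b / a)) * (\<integral>\<omega>. (norm (v \<omega>))\<^sup>2 \<partial>M)"
      using u(1) v(1) by (simp add: sq_integrable_def)
    also have "\<dots> \<le> (1 + b / a) * a\<^sup>2 + (1 + 1 / (b / a)) * b\<^sup>2"
    proof -
      have "A\<^sup>2 \<le> a\<^sup>2" "B\<^sup>2 \<le> b\<^sup>2"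
        using ab u(3) v(3) by (auto intro: power_mono)
      then show ?thesis
        using ab u(2) v(2) by (intro add_mono mult_left_mono) auto
    qed
    also have "\<dots> = (a + b)\<^sup>2"
      using ab by (simp add: field_simps power2_eq_square)
    finally have "sqrt ?I \<le> a + b"
      using ab by (intro real_le_lsqrt) auto
    then show ?thesis
      by (simp add: a_def b_def)
  qed
  then have "sqrt ?I \<le> A + B"
    by (rule field_le_epsilon)
  then show ?thesis
    by (rule sqrt_le_D)
qed

section \<open>Averages over the workers\<close>

definition average :: "nat \<Rightarrow> (nat \<Rightarrow> 'a::real_vector) \<Rightarrow> 'a" where
  "average n v = (1 / real n) *\<^sub>R (\<Sum>i\<in>{1..n}. v i)"

lemma average_add: "average n (\<lambda>i. u i + v i) = average n u + average n v"
  and average_diff: "average n (\<lambda>i. u i - v i) = average n u - average n v"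
  by (simp_all add: average_def sum.distrib sum_subtractf scaleR_add_right scaleR_diff_right)

lemma average_scaleR: "average n (\<lambda>i. c *\<^sub>R v i) = c *\<^sub>R average n v"
  by (simp add: average_def scaleR_sum_right)

lemma average_const: "0 < n \<Longrightarrow> average n (\<lambda>i. c) = c"
  by (simp add: average_def sum_constant_scaleR)

lemma average_cong: "(\<And>i. i \<in> {1..n} \<Longrightarrow> u i = v i) \<Longrightarrow> average n u = average n v"
  by (simp add: average_def)

lemma sq_integrable_average:
  assumes "\<And>i. i \<in> {1..n} \<Longrightarrow> sq_integrable M (u i)" "finite_measure M"
  shows "sq_integrable M (\<lambda>\<omega>. average n (\<lambda>i. u i \<omega>))"
  unfolding average_def by (intro sq_integrable_scaleR sq_integrable_sum assms)

lemma borel_measurable_average [measurable]: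
  fixes u :: "nat \<Rightarrow> 'w \<Rightarrow> 'a::euclidean_space"
  assumes "\<And>i. i \<in> {1..n} \<Longrightarrow> u i \<in> borel_measurable N"
  shows "(\<lambda>\<omega>. average n (\<lambda>i. u i \<omega>)) \<in> borel_measurable N"
  unfolding average_def using assms by (intro borel_measurable_scaleR borel_measurable_sum) auto

lemma norm_sq_average_expectation_le:
  assumes u: "\<And>i. i \<in> {1..n} \<Longrightarrow> sq_integrable M (u i)" and "finite_measure M" "0 < n"
    and b: "\<And>i. i \<in> {1..n} \<Longrightarrow> (\<integral>\<omega>. (norm (u i \<omega>))\<^sup>2 \<partial>M) \<le> B"
  shows "(\<integral>\<omega>. (norm (average n (\<lambda>i. u i \<omega>)))\<^sup>2 \<partial>M) \<le> B"
proof -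
  have "(\<integral>\<omega>. (norm (average n (\<lambda>i. u i \<omega>)))\<^sup>2 \<partial>M)
      \<le> (\<integral>\<omega>. (1 / real n) * (\<Sum>i\<in>{1..n}. (norm (u i \<omega>))\<^sup>2) \<partial>M)"
    using sq_integrable_average [OF u assms(2)] u norm_sq_average_le
    by (intro integral_mono integrable_mult_right Bochner_Integration.integrable_sum)
      (auto simp: sq_integrable_def average_def)
  also have "\<dots> = (1 / real n) * (\<Sum>i\<in>{1..n}. \<integral>\<omega>. (norm (u i \<omega>))\<^sup>2 \<partial>M)"
    using u by (subst integral_mult_right_zero, subst Bochner_Integration.integral_sum)
      (auto simp: sq_integrable_def)
  also have "\<dots> \<le> (1 / real n) * (\<Sum>i\<in>{1..n}. B)"
    using b by (intro mult_left_mono sum_mono) auto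
  finally show ?thesis
    using \<open>0 < n\<close> by simp
qed

section \<open>Sample paths of M-CSER\<close>

locale mcser_run =
  fixes n H :: nat and \<beta> \<eta> :: real and C1 C2 :: "'a::euclidean_space \<Rightarrow> 'a"
    and f :: "'a \<Rightarrow> 'z \<Rightarrow> real" and x0 :: 'a
begin

definition st where "st \<zeta> t = mcser n H \<beta> \<eta> C1 C2 f x0 \<zeta> t"
definition x where "x \<zeta> t i = fst (st \<zeta> t) i"
definition e where "e \<zeta> t i = fst (snd (st \<zeta> t)) i"
definition m where "m \<zeta> t i = snd (snd (st \<zeta> t)) i"
text \<open>Indices are shifted by one: \<open>g \<zeta> t\<close> is computed at the iterate after
  \<open>t\<close> iterations with the sample numbered \<open>Suc t\<close>, so it is the gradient
  of iteration \<open>t + 1\<close>. The same holds for \<open>p\<close> and for \<open>eh\<close>,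
  the error before a possible synchronization.\<close>

definition g where "g \<zeta> t i = stoch_grad f (x \<zeta> t i) (\<zeta> i (Suc t))"
definition p where "p \<zeta> t i = \<eta> *\<^sub>R (\<beta> *\<^sub>R m \<zeta> (Suc t) i + g \<zeta> t i)"
definition eh where "eh \<zeta> t i = e \<zeta> t i - (p \<zeta> t i - C2 (p \<zeta> t i))"

lemma x_0: "x \<zeta> 0 i = x0" and e_0: "e \<zeta> 0 i = 0" and m_0: "m \<zeta> 0 i = 0"
  by (simp_all add: x_def e_def m_def st_def)

lemma m_Suc: "m \<zeta> (Suc t) i = \<beta> *\<^sub>R m \<zeta> t i + g \<zeta> t i"
  by (simp add: m_def g_def x_def st_def split_beta Let_def)

lemma p_eq: "p \<zeta> t i = \<eta> *\<^sub>R (\<beta> *\<^sub>R (\<beta> *\<^sub>R snd (snd (st \<zeta> t)) i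
    + stoch_grad f (fst (st \<zeta> t) i) (\<zeta> i (Suc t))) + stoch_grad f (fst (st \<zeta> t) i) (\<zeta> i (Suc t)))"
  unfolding p_def m_Suc by (simp add: m_def g_def x_def)

lemma e_Suc: "e \<zeta> (Suc t) i = (if H dvd Suc t then eh \<zeta> t i - C1 (eh \<zeta> t i) else eh \<zeta> t i)"
  unfolding eh_def p_eq by (simp add: e_def st_def psync_def split_beta Let_def)

lemma x_Suc: "x \<zeta> (Suc t) i =
    (let xh = x \<zeta> t i - (average n (\<lambda>k. C2 (p \<zeta> t k)) + (p \<zeta> t i - C2 (p \<zeta> t i)))
     in if H dvd Suc t
        then xh - eh \<zeta> t i + (average n (\<lambda>k. C1 (eh \<zeta> t k)) + (eh \<zeta> t i - C1 (eh \<zeta> t i)))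
        else xh)"
  unfolding eh_def p_eq by (simp add: x_def e_def st_def psync_def average_def split_beta Let_def)

text \<open>Both synchronizations change the model and the error of a worker by the same local amount,
  so the difference of model and error stays common to all workers.\<close>

lemma x_minus_e_common: "x \<zeta> t i - e \<zeta> t i = x \<zeta> t j - e \<zeta> t j"
proof (induction t)
  case (Suc t)
  have "x \<zeta> (Suc t) i - e \<zeta> (Suc t) i = x \<zeta> t i - e \<zeta> t i
      - average n (\<lambda>k. C2 (p \<zeta> t k)) + (if H dvd Suc t then average n (\<lambda>k. C1 (eh \<zeta> t k)) else 0)" for i
    by (simp add: x_Suc e_Suc Let_def) (simp add: eh_def)
  with Suc show ?case
    by simp
qed (simp add: x_0 e_0)

definition xbar where "xbar \<zeta> t = average n (x \<zeta> t)"

lemma xbar_Suc: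
  assumes "0 < n"
  shows "xbar \<zeta> (Suc t) = xbar \<zeta> t - average n (p \<zeta> t)"
proof -
  have "xbar \<zeta> (Suc t) = average n (\<lambda>i. x \<zeta> (Suc t) i)"
    by (simp add: xbar_def)
  also have "\<dots> = average n (x \<zeta> t) - average n (p \<zeta> t)"
    unfolding x_Suc Let_def
    by (cases "H dvd Suc t") (simp_all add: average_add average_diff average_const [OF assms])
  finally show ?thesis
    by (simp add: xbar_def)
qed

lemma consensus_deviation:
  assumes "0 < n"
  shows "x \<zeta> t i - xbar \<zeta> t = e \<zeta> t i - average n (e \<zeta> t)"
proof -
  have "xbar \<zeta> t - average n (e \<zeta> t) = average n (\<lambda>j. x \<zeta> t j - e \<zeta> t j)"
    by (simp add: xbar_def average_diff)
  also have "\<dots> = average n (\<lambda>j. x \<zeta> t i - e \<zeta> t i)"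
    by (rule average_cong) (rule x_minus_e_common)
  also have "\<dots> = x \<zeta> t i - e \<zeta> t i"
    by (rule average_const [OF assms])
  finally show ?thesis
    by (simp add: algebra_simps)
qed

text \<open>The coefficient \<open>c\<close> of the momentum solves
  \<open>c - \<eta> * \<beta>\<^sup>2 - c * \<beta> = 0\<close>, the condition that the old momentum
  cancels in \<open>y \<zeta> (Suc t) - y \<zeta> t\<close>. The square of \<open>\<beta>\<close>
  appears because \<open>p\<close> applies \<open>\<beta>\<close> to the already updated
  momentum.\<close>

definition y where
  "y \<zeta> t = xbar \<zeta> t - (\<eta> * \<beta>\<^sup>2 / (1 - \<beta>)) *\<^sub>R average n (m \<zeta> t)"

lemma y_Suc:
  assumes "0 < n" "\<beta> < 1"
  shows "y \<zeta> (Suc t) = y \<zeta> t - (\<eta> / (1 - \<beta>)) *\<^sub>R average n (g \<zeta> t)"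
proof -
  let ?m = "average n (m \<zeta> t)" and ?g = "average n (g \<zeta> t)"
  have "average n (m \<zeta> (Suc t)) = average n (\<lambda>i. \<beta> *\<^sub>R m \<zeta> t i + g \<zeta> t i)"
    by (rule average_cong) (rule m_Suc)
  then have m: "average n (m \<zeta> (Suc t)) = \<beta> *\<^sub>R ?m + ?g"
    by (simp add: average_add average_scaleR)
  have "average n (p \<zeta> t) = average n (\<lambda>i. \<eta> *\<^sub>R (\<beta> *\<^sub>R m \<zeta> (Suc t) i + g \<zeta> t i))"
    by (rule average_cong) (rule p_def)
  then have p: "average n (p \<zeta> t) = \<eta> *\<^sub>R (\<beta> *\<^sub>R (\<beta> *\<^sub>R ?m + ?g) + ?g)"
    by (simp add: average_add average_scaleR m)
  have "y \<zeta> (Suc t) - y \<zeta> t = (\<eta> * \<beta>\<^sup>2 / (1 - \<beta>) - \<eta> * \<beta>\<^sup>2 - \<eta> * \<beta>\<^sup>2 / (1 - \<beta>) * \<beta>) *\<^sub>R ?m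
      - (\<eta> * \<beta> + \<eta> + \<eta> * \<beta>\<^sup>2 / (1 - \<beta>)) *\<^sub>R ?g"
    unfolding y_def xbar_Suc [OF assms(1)] m p
    by (simp add: algebra_simps power2_eq_square)
  also have "\<eta> * \<beta>\<^sup>2 / (1 - \<beta>) - \<eta> * \<beta>\<^sup>2 - \<eta> * \<beta>\<^sup>2 / (1 - \<beta>) * \<beta> = 0"
    using assms(2) by (simp add: field_simps)
  also have "\<eta> * \<beta> + \<eta> + \<eta> * \<beta>\<^sup>2 / (1 - \<beta>) = \<eta> / (1 - \<beta>)"
    using assms(2) by (simp add: field_simps power2_eq_square)
  finally show ?thesis
    by (simp add: algebra_simps)
qed

lemma y_minus_xbar: "norm (y \<zeta> t - xbar \<zeta> t) = \<bar>\<eta> * \<beta>\<^sup>2 / (1 - \<beta>)\<bar> * norm (average n (m \<zeta> t))"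
  by (simp add: y_def)

text \<open>Adaptedness of the iterates. Agreement is required only at the samples already drawn by
  actual workers, because the independence argument replaces a path by its restriction to an index
  set, which is \<open>undefined\<close> elsewhere.\<close>

lemma state_cong:
  assumes "\<And>i s. i \<in> {1..n} \<Longrightarrow> s \<in> {1..t} \<Longrightarrow> \<zeta> i s = \<zeta>' i s" "i \<in> {1..n}"
  shows "x \<zeta> t i = x \<zeta>' t i \<and> e \<zeta> t i = e \<zeta>' t i \<and> m \<zeta> t i = m \<zeta>' t i"
  using assms
proof (induction t arbitrary: i)
  case (Suc t)
  have IH: "x \<zeta> t i = x \<zeta>' t i" "e \<zeta> t i = e \<zeta>' t i" "m \<zeta> t i = m \<zeta>' t i" if "i \<in> {1..n}" for i
    using Suc that by simp_all
  have g: "g \<zeta> t i = g \<zeta>' t i" if "i \<in> {1..n}" for i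
    using Suc.prems(1) [of i "Suc t"] that by (simp add: g_def IH)
  have m: "m \<zeta> (Suc t) i = m \<zeta>' (Suc t) i" if "i \<in> {1..n}" for i
    using that by (simp add: m_Suc IH g)
  have p: "p \<zeta> t i = p \<zeta>' t i" if "i \<in> {1..n}" for i
    using that by (simp add: p_def m g)
  have eh: "eh \<zeta> t i = eh \<zeta>' t i" if "i \<in> {1..n}" for i
    using that by (simp add: eh_def p IH)
  have "average n (\<lambda>k. C2 (p \<zeta> t k)) = average n (\<lambda>k. C2 (p \<zeta>' t k))"
    "average n (\<lambda>k. C1 (eh \<zeta> t k)) = average n (\<lambda>k. C1 (eh \<zeta>' t k))"
    by (auto intro!: average_cong simp: p eh)
  then show ?case
    using Suc.prems(2) by (simp add: x_Suc e_Suc m IH p eh)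
qed (simp add: x_0 e_0 m_0)

lemma g_cong:
  assumes "\<And>i s. i \<in> {1..n} \<Longrightarrow> s \<in> {1..t} \<Longrightarrow> \<zeta> i s = \<zeta>' i s" "i \<in> {1..n}"
    "\<zeta> i (Suc t) = \<zeta>' i (Suc t)"
  shows "g \<zeta> t i = g \<zeta>' t i"
  using state_cong [OF assms(1,2)] assms(3) by (simp add: g_def)

lemma xbar_cong:
  assumes "\<And>i s. i \<in> {1..n} \<Longrightarrow> s \<in> {1..t} \<Longrightarrow> \<zeta> i s = \<zeta>' i s"
  shows "xbar \<zeta> t = xbar \<zeta>' t"
  using state_cong [OF assms] by (auto simp: xbar_def intro!: average_cong)

lemma y_cong:
  assumes "\<And>i s. i \<in> {1..n} \<Longrightarrow> s \<in> {1..t} \<Longrightarrow> \<zeta> i s = \<zeta>' i s"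
  shows "y \<zeta> t = y \<zeta>' t"
proof -
  have "average n (m \<zeta> t) = average n (m \<zeta>' t)"
    using state_cong [OF assms] by (auto intro!: average_cong)
  then show ?thesis
    using xbar_cong [OF assms] by (simp add: y_def)
qed

section \<open>Measurability of the iterates\<close>

context
  fixes D :: "nat \<Rightarrow> 'z measure"
  assumes sg: "\<And>i. i \<in> {1..n} \<Longrightarrow> (\<lambda>(x, z). stoch_grad f x z) \<in> borel_measurable (borel \<Otimes>\<^sub>M D i)"
    and C1 [measurable]: "C1 \<in> borel_measurable borel"
    and C2 [measurable]: "C2 \<in> borel_measurable borel"
begin

lemma g_measurable_aux:
  assumes "i \<in> {1..n}" "(\<lambda>w. x (\<zeta> w) t i) \<in> borel_measurable N" "(\<lambda>w. \<zeta> w i (Suc t)) \<in> measurable N (D i)"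
  shows "(\<lambda>w. g (\<zeta> w) t i) \<in> borel_measurable N"
  using measurable_compose [OF measurable_Pair [OF assms(2,3)] sg [OF assms(1)]] by (simp add: g_def)

text \<open>The path is an arbitrary function of a point of \<open>N\<close>, so that one induction
  serves both the probability space \<open>M\<close> and the product spaces on which
  \<open>path_functional\<close> is defined.\<close>

lemma state_measurable:
  assumes "\<And>i s. i \<in> {1..n} \<Longrightarrow> s \<in> {1..t} \<Longrightarrow> (\<lambda>w. \<zeta> w i s) \<in> measurable N (D i)" "i \<in> {1..n}"
  shows "(\<lambda>w. x (\<zeta> w) t i) \<in> borel_measurable N \<and> (\<lambda>w. e (\<zeta> w) t i) \<in> borel_measurable N
    \<and> (\<lambda>w. m (\<zeta> w) t i) \<in> borel_measurable N"
  using assms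
proof (induction t arbitrary: i)
  case (Suc t)
  have IH [measurable]: "(\<lambda>w. x (\<zeta> w) t i) \<in> borel_measurable N" "(\<lambda>w. e (\<zeta> w) t i) \<in> borel_measurable N"
    "(\<lambda>w. m (\<zeta> w) t i) \<in> borel_measurable N" if "i \<in> {1..n}" for i
    using Suc that by simp_all
  have g [measurable]: "(\<lambda>w. g (\<zeta> w) t i) \<in> borel_measurable N" if "i \<in> {1..n}" for i
    using Suc.prems(1) [of i "Suc t"] that by (intro g_measurable_aux IH) auto
  have m [measurable]: "(\<lambda>w. m (\<zeta> w) (Suc t) i) \<in> borel_measurable N" if "i \<in> {1..n}" for i
    unfolding m_Suc using IH(3) [OF that] g [OF that] by measurable
  have p [measurable]: "(\<lambda>w. p (\<zeta> w) t i) \<in> borel_measurable N" if "i \<in> {1..n}" for i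
    unfolding p_def using m [OF that] g [OF that] by measurable
  have eh [measurable]: "(\<lambda>w. eh (\<zeta> w) t i) \<in> borel_measurable N" if "i \<in> {1..n}" for i
    unfolding eh_def using IH(2) [OF that] p [OF that] by measurable
  have a1: "(\<lambda>w. average n (\<lambda>k. C2 (p (\<zeta> w) t k))) \<in> borel_measurable N"
    using p by (intro borel_measurable_average measurable_compose [OF _ C2])
  have a2: "(\<lambda>w. average n (\<lambda>k. C1 (eh (\<zeta> w) t k))) \<in> borel_measurable N"
    using eh by (intro borel_measurable_average measurable_compose [OF _ C1])
  have "(\<lambda>w. x (\<zeta> w) (Suc t) i) \<in> borel_measurable N"
    unfolding x_Suc Let_def
    using IH(1) [OF Suc.prems(2)] p [OF Suc.prems(2)] eh [OF Suc.prems(2)] a1 a2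
    by (cases "H dvd Suc t") (simp_all, measurable)
  moreover have "(\<lambda>w. e (\<zeta> w) (Suc t) i) \<in> borel_measurable N"
    unfolding e_Suc using eh [OF Suc.prems(2)] by (cases "H dvd Suc t") (simp_all)
  ultimately show ?case
    using m [OF Suc.prems(2)] by blast
qed (simp add: x_0 e_0 m_0)

lemma g_measurable:
  assumes "\<And>i s. i \<in> {1..n} \<Longrightarrow> s \<in> {1..t} \<Longrightarrow> (\<lambda>w. \<zeta> w i s) \<in> measurable N (D i)" "i \<in> {1..n}"
    "(\<lambda>w. \<zeta> w i (Suc t)) \<in> measurable N (D i)"
  shows "(\<lambda>w. g (\<zeta> w) t i) \<in> borel_measurable N"
  using state_measurable [OF assms(1,2)] by (intro g_measurable_aux assms) auto

lemma xbar_measurable: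
  assumes "\<And>i s. i \<in> {1..n} \<Longrightarrow> s \<in> {1..t} \<Longrightarrow> (\<lambda>w. \<zeta> w i s) \<in> measurable N (D i)"
  shows "(\<lambda>w. xbar (\<zeta> w) t) \<in> borel_measurable N"
  unfolding xbar_def using state_measurable [OF assms] by (intro borel_measurable_average) auto

lemma y_measurable:
  assumes "\<And>i s. i \<in> {1..n} \<Longrightarrow> s \<in> {1..t} \<Longrightarrow> (\<lambda>w. \<zeta> w i s) \<in> measurable N (D i)"
  shows "(\<lambda>w. y (\<zeta> w) t) \<in> borel_measurable N"
proof -
  have "(\<lambda>w. average n (m (\<zeta> w) t)) \<in> borel_measurable N"
    using state_measurable [OF assms] by (intro borel_measurable_average) auto
  then show ?thesis
    unfolding y_def using xbar_measurable [OF assms] by measurable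
qed

end

end

section \<open>Orthogonality of the gradient noise\<close>

lemma norm_sq_average_eq:
  fixes u :: "nat \<Rightarrow> 'a::real_inner"
  shows "(norm (average n u))\<^sup>2 = (1 / (real n)\<^sup>2) * (\<Sum>i\<in>{1..n}. \<Sum>j\<in>{1..n}. inner (u i) (u j))"
  unfolding average_def norm_scaleR power_mult_distrib power2_norm_eq_inner inner_sum_left
  unfolding inner_sum_right by (simp add: power_divide)

locale mcser_problem = mcser_run n H \<beta> \<eta> C1 C2 f x0 + prob_space M
  for n H :: nat and \<beta> \<eta> :: real and C1 C2 :: "'a::euclidean_space \<Rightarrow> 'a"
    and f :: "'a \<Rightarrow> 'z \<Rightarrow> real" and x0 :: 'a and M :: "'w measure" +
  fixes L V1 V1' \<delta>1 \<delta>2 :: real and T :: nat and D :: "nat \<Rightarrow> 'z measure"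
    and Z :: "nat \<Rightarrow> nat \<Rightarrow> 'w \<Rightarrow> 'z" and xstar :: 'a
  assumes asm: "mcser_assumptions L V1 V1' \<delta>1 \<delta>2 H \<beta> \<eta> n T C1 C2 M D f Z x0 xstar"
    and \<delta>1: "0 < \<delta>1" and \<beta>0: "0 \<le> \<beta>" and \<beta>1: "\<beta> < 1" and \<eta>: "0 < \<eta>" and H: "0 < H" and T: "0 < T"
begin

definition V2 where "V2 = V1 + V1'"
definition F where "F = global_obj n D f"
definition dF where "dF i = grad (local_obj D f i)"
definition path where "path \<omega> = (\<lambda>k s. Z k s \<omega>)"
definition noise where "noise \<zeta> t i = g \<zeta> t i - dF i (x \<zeta> t i)"
definition mean_grad where "mean_grad \<zeta> t = average n (\<lambda>i. dF i (x \<zeta> t i))"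

lemma mcser_x_eq: "mcser_x n H \<beta> \<eta> C1 C2 f x0 Z i t \<omega> = x (path \<omega>) t i"
  by (simp add: mcser_x_def path_def x_def st_def)

lemma mcser_mean_eq: "mcser_mean n H \<beta> \<eta> C1 C2 f x0 Z t \<omega> = xbar (path \<omega>) t"
  by (simp add: mcser_mean_def mcser_x_eq xbar_def average_def)

section \<open>Consequences of the assumptions\<close>

lemma problem: "stochastic_problem n D f"
  and sampling: "mcser_sampling M n T D Z"
  and bounds: "gradient_bounds M n T D f Z (mcser_x n H \<beta> \<eta> C1 C2 f x0 Z) V1 V1'"
  and comp1: "approx_compressor \<delta>1 C1" and comp2: "approx_compressor \<delta>2 C2"
  and C1: "C1 \<in> borel_measurable borel" and C2: "C2 \<in> borel_measurable borel"
  and xstar: "F xstar \<le> F u"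
  and smooth: "i \<in> {1..n} \<Longrightarrow> L_smooth L (local_obj D f i)"
  using asm by (auto simp: mcser_assumptions_def F_def)

lemma n_pos: "0 < n"
  using problem by (simp add: stochastic_problem_def)

lemma D_prob_space: "i \<in> {1..n} \<Longrightarrow> prob_space (D i)"
  using problem by (auto simp: stochastic_problem_def)

lemma stoch_grad_integrable: "i \<in> {1..n} \<Longrightarrow> integrable (D i) (stoch_grad f u)"
  using problem by (auto simp: stochastic_problem_def)

lemma dF_eq: "i \<in> {1..n} \<Longrightarrow> dF i u = (\<integral>z. stoch_grad f u z \<partial>D i)"
  using problem by (auto simp: stochastic_problem_def dF_def intro!: grad_eq)

lemma stoch_grad_measurable:
  "i \<in> {1..n} \<Longrightarrow> (\<lambda>(u, z). stoch_grad f u z) \<in> borel_measurable (borel \<Otimes>\<^sub>M D i)"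
  using problem by (intro borel_measurable_stoch_grad) (auto simp: stochastic_problem_def intro!: borel_measurable_integrable)

lemma F_smooth: "L_smooth L F" and grad_F: "grad F u = average n (\<lambda>i. dF i u)"
proof -
  have F: "F = (\<lambda>u. (1 / real n) * (\<Sum>i\<in>{1..n}. local_obj D f i u))"
    by (simp add: F_def global_obj_def [abs_def])
  show "L_smooth L F"
    unfolding F using smooth n_pos by (rule L_smooth_average)
  show "grad F u = average n (\<lambda>i. dF i u)"
    unfolding F average_def dF_def using smooth n_pos by (rule grad_average)
qed

lemma L_nonneg: "0 \<le> L"
  using F_smooth by (rule L_smooth_nonneg)

lemma dF_Lipschitz: "i \<in> {1..n} \<Longrightarrow> norm (dF i u - dF i v) \<le> L * norm (u - v)"
  unfolding dF_def using smooth by (rule L_smooth_Lipschitz)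

lemma dF_continuous: "i \<in> {1..n} \<Longrightarrow> continuous_on UNIV (dF i)"
  unfolding dF_def using smooth by (rule L_smooth_grad_continuous)

lemma dF_measurable: "i \<in> {1..n} \<Longrightarrow> dF i \<in> borel_measurable borel"
  by (intro borel_measurable_continuous_onI dF_continuous)

lemma grad_F_measurable: "grad F \<in> borel_measurable borel"
  by (intro borel_measurable_continuous_onI L_smooth_grad_continuous [OF F_smooth])

lemma Z_measurable: "i \<in> {1..n} \<Longrightarrow> s \<in> {1..T} \<Longrightarrow> Z i s \<in> measurable M (D i)"
  using sampling by (auto simp: mcser_sampling_def indep_vars_def)

lemma path_measurable:
  "i \<in> {1..n} \<Longrightarrow> s \<in> {1..t} \<Longrightarrow> t \<le> T \<Longrightarrow> (\<lambda>\<omega>. path \<omega> i s) \<in> measurable M (D i)"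
  using Z_measurable [of i s] by (simp add: path_def)

text \<open>The functions of the samples with index in \<open>J\<close> alone. Measurability is
  required on the product over \<open>J\<close>, since independence is a statement about tuples of
  samples; the second clause permits evaluating \<open>\<Psi>\<close> at the tuple instead of the
  whole path.\<close>

definition path_functional :: "(nat \<times> nat) set \<Rightarrow> ((nat \<Rightarrow> nat \<Rightarrow> 'z) \<Rightarrow> 'a) \<Rightarrow> bool" where
  "path_functional J \<Psi> \<longleftrightarrow>
     (\<lambda>w. \<Psi> (\<lambda>k s. w (k, s))) \<in> borel_measurable (PiM J (\<lambda>(k, s). D k)) \<and>
     (\<forall>\<zeta> \<zeta>'. (\<forall>(k, s)\<in>J. \<zeta> k s = \<zeta>' k s) \<longrightarrow> \<Psi> \<zeta> = \<Psi> \<zeta>')"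

lemma path_functional_cong:
  assumes "path_functional J \<Psi>" "\<And>k s. (k, s) \<in> J \<Longrightarrow> \<zeta> k s = \<zeta>' k s"
  shows "\<Psi> \<zeta> = \<Psi> \<zeta>'"
proof -
  have "\<forall>(k, s)\<in>J. \<zeta> k s = \<zeta>' k s"
    using assms(2) by blast
  with assms(1) show ?thesis
    by (simp only: path_functional_def)
qed

lemma component_measurable:
  "(k, s) \<in> J \<Longrightarrow> (\<lambda>w. w (k, s)) \<in> measurable (PiM J (\<lambda>(k, s). D k)) (D k)"
  using measurable_component_singleton [of "(k, s)" J "\<lambda>(k, s). D k"] by simp

lemma path_functional_state:
  assumes "{1..n} \<times> {1..t} \<subseteq> J" "i \<in> {1..n}"
  shows "path_functional J (\<lambda>\<zeta>. x \<zeta> t i)"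
proof -
  have "(\<lambda>w. x (\<lambda>k s. w (k, s)) t i) \<in> borel_measurable (PiM J (\<lambda>(k, s). D k))"
    using assms by (intro conjunct1 [OF state_measurable [of D]])
      (auto intro!: component_measurable stoch_grad_measurable C1 C2)
  moreover have "x \<zeta> t i = x \<zeta>' t i" if "\<forall>(k, s)\<in>J. \<zeta> k s = \<zeta>' k s" for \<zeta> \<zeta>'
    using state_cong [of t \<zeta> \<zeta>' i] assms that by blast
  ultimately show ?thesis
    by (auto simp: path_functional_def)
qed

lemma path_functional_y:
  assumes "{1..n} \<times> {1..t} \<subseteq> J"
  shows "path_functional J (\<lambda>\<zeta>. y \<zeta> t)"
proof -
  have "(\<lambda>w. y (\<lambda>k s. w (k, s)) t) \<in> borel_measurable (PiM J (\<lambda>(k, s). D k))"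
    using assms
    by (intro y_measurable [of D]) (auto intro!: component_measurable stoch_grad_measurable C1 C2)
  moreover have "y \<zeta> t = y \<zeta>' t" if "\<forall>(k, s)\<in>J. \<zeta> k s = \<zeta>' k s" for \<zeta> \<zeta>'
    using assms that by (intro y_cong) blast
  ultimately show ?thesis
    by (auto simp: path_functional_def)
qed

lemma path_functional_g:
  assumes "{1..n} \<times> {1..t} \<subseteq> J" "i \<in> {1..n}" "(i, Suc t) \<in> J"
  shows "path_functional J (\<lambda>\<zeta>. g \<zeta> t i)"
proof -
  have "(\<lambda>w. g (\<lambda>k s. w (k, s)) t i) \<in> borel_measurable (PiM J (\<lambda>(k, s). D k))"
    using assms
    by (intro g_measurable [of D]) (auto intro!: component_measurable stoch_grad_measurable C1 C2)
  moreover have "g \<zeta> t i = g \<zeta>' t i" if "\<forall>(k, s)\<in>J. \<zeta> k s = \<zeta>' k s" for \<zeta> \<zeta>'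
    using assms that by (intro g_cong) blast+
  ultimately show ?thesis
    by (auto simp: path_functional_def)
qed

lemma path_functional_compose:
  assumes "path_functional J \<Psi>" "k \<in> borel_measurable borel"
  shows "path_functional J (\<lambda>\<zeta>. k (\<Psi> \<zeta>))"
  using assms measurable_compose [OF _ assms(2)] unfolding path_functional_def by fastforce

lemma path_functional_diff:
  assumes "path_functional J \<Psi>" "path_functional J \<Psi>'"
  shows "path_functional J (\<lambda>\<zeta>. \<Psi> \<zeta> - \<Psi>' \<zeta>)"
proof -
  have "(\<lambda>w. \<Psi> (\<lambda>k s. w (k, s)) - \<Psi>' (\<lambda>k s. w (k, s))) \<in> borel_measurable (PiM J (\<lambda>(k, s). D k))"
    using assms by (intro borel_measurable_diff) (simp_all add: path_functional_def)
  moreover have "\<Psi> \<zeta> - \<Psi>' \<zeta> = \<Psi> \<zeta>' - \<Psi>' \<zeta>'" if "\<forall>(k, s)\<in>J. \<zeta> k s = \<zeta>' k s" for \<zeta> \<zeta>'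
    using assms that unfolding path_functional_def by metis
  ultimately show ?thesis
    by (auto simp: path_functional_def)
qed

lemma path_functional_average:
  assumes "\<And>i. i \<in> {1..n} \<Longrightarrow> path_functional J (\<lambda>\<zeta>. u \<zeta> i)"
  shows "path_functional J (\<lambda>\<zeta>. average n (u \<zeta>))"
proof -
  have "(\<lambda>w. average n (u (\<lambda>k s. w (k, s)))) \<in> borel_measurable (PiM J (\<lambda>(k, s). D k))"
    by (rule borel_measurable_average) (use assms in \<open>simp add: path_functional_def\<close>)
  moreover have "average n (u \<zeta>) = average n (u \<zeta>')" if "\<forall>(k, s)\<in>J. \<zeta> k s = \<zeta>' k s" for \<zeta> \<zeta>'
    using assms that unfolding path_functional_def by (intro average_cong) blast
  ultimately show ?thesis
    by (auto simp: path_functional_def)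
qed

text \<open>Only one sample is left out, not a whole iteration. One orthogonality statement then
  covers both functions of the past and the noise of the other workers in the same
  iteration.\<close>

definition others :: "nat \<Rightarrow> nat \<Rightarrow> (nat \<times> nat) set" where
  "others i t = {1..n} \<times> {1..T} - {(i, Suc t)}"

text \<open>Conditionally on all other samples, the noise of worker \<open>i\<close> in step \<open>t + 1\<close> has mean zero.\<close>

lemma noise_orthogonal:
  assumes it: "i \<in> {1..n}" "t < T" and \<Psi>: "path_functional (others i t) \<Psi>"
    and int: "integrable M (\<lambda>\<omega>. inner (\<Psi> (path \<omega>)) (noise (path \<omega>) t i))"
  shows "(\<integral>\<omega>. inner (\<Psi> (path \<omega>)) (noise (path \<omega>) t i) \<partial>M) = 0"
proof -
  let ?J = "others i t" and ?D = "\<lambda>(k, s). D k" and ?j = "(i, Suc t)"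
  let ?P = "PiM ?J ?D" and ?Q = "PiM {?j} ?D"
  define W where "W \<omega> = (\<lambda>q\<in>?J. (case q of (k, s) \<Rightarrow> Z k s) \<omega>)" for \<omega>
  define X where "X \<omega> = (\<lambda>q\<in>{?j}. (case q of (k, s) \<Rightarrow> Z k s) \<omega>)" for \<omega>
  define u where "u w = x (\<lambda>k s. w (k, s)) t i" for w
  \<comment> \<open>The integrand as a function of two independent arguments: the other samples
    \<open>w\<close>, which determine the iterate \<open>u w\<close>, and the fresh sample
    \<open>v\<close>.\<close>
  define h where "h = (\<lambda>(w, v). inner (\<Psi> (\<lambda>k s. w (k, s))) (stoch_grad f (u w) (v ?j) - dF i (u w)))"
  have sub: "{1..n} \<times> {1..t} \<subseteq> ?J"
    using it by (auto simp: others_def)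
  have Z [measurable]: "Z i (Suc t) \<in> measurable M (D i)"
    using it by (intro Z_measurable) auto
  have ind: "indep_vars ?D (\<lambda>(k, s). Z k s) ({1..n} \<times> {1..T})"
    using sampling by (simp add: mcser_sampling_def)
  have "indep_var ?P W ?Q X"
    unfolding W_def X_def
    using it by (intro indep_var_restrict [OF ind]) (auto simp: others_def)
  then have W [measurable]: "W \<in> measurable M ?P" and X [measurable]: "X \<in> measurable M ?Q"
    and joint: "distr M ?P W \<Otimes>\<^sub>M distr M ?Q X = distr M (?P \<Otimes>\<^sub>M ?Q) (\<lambda>\<omega>. (W \<omega>, X \<omega>))"
    by (auto simp: indep_var_distribution_eq)
  have distr_Z: "distr M (D i) (Z i (Suc t)) = D i"
    using sampling it by (auto simp: mcser_sampling_def)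
  have u [measurable]: "u \<in> borel_measurable ?P"
    using path_functional_state [OF sub it(1)] by (simp add: path_functional_def u_def [abs_def])
  have [measurable]: "(\<lambda>w. \<Psi> (\<lambda>k s. w (k, s))) \<in> borel_measurable ?P"
    using \<Psi> by (simp add: path_functional_def)
  have [measurable]: "dF i \<in> borel_measurable borel"
    by (rule dF_measurable [OF it(1)])
  have [measurable]: "(\<lambda>v. v ?j) \<in> measurable ?Q (D i)"
    by (rule component_measurable) simp
  have "(\<lambda>q. (u (fst q), snd q ?j)) \<in> measurable (?P \<Otimes>\<^sub>M ?Q) (borel \<Otimes>\<^sub>M D i)"
    by measurable
  from measurable_compose [OF this stoch_grad_measurable [OF it(1)]]
  have [measurable]: "(\<lambda>q. stoch_grad f (u (fst q)) (snd q ?j)) \<in> borel_measurable (?P \<Otimes>\<^sub>M ?Q)"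
    by simp
  have h [measurable]: "h \<in> borel_measurable (?P \<Otimes>\<^sub>M ?Q)"
    unfolding h_def by measurable
  have eq: "h (W \<omega>, X \<omega>) = inner (\<Psi> (path \<omega>)) (noise (path \<omega>) t i)" for \<omega>
  proof -
    have "\<Psi> (\<lambda>k s. W \<omega> (k, s)) = \<Psi> (path \<omega>)"
      by (rule path_functional_cong [OF \<Psi>]) (simp add: W_def path_def)
    moreover have "u (W \<omega>) = x (path \<omega>) t i"
      unfolding u_def
      by (rule path_functional_cong [OF path_functional_state [OF sub it(1)]])
        (simp add: W_def path_def)
    ultimately show ?thesis
      by (simp add: h_def noise_def g_def X_def path_def)
  qed
  interpret PW: prob_space "distr M ?P W"
    by (rule prob_space_distr [OF W])
  interpret PX: prob_space "distr M ?Q X"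
    by (rule prob_space_distr [OF X])
  interpret PP: pair_prob_space "distr M ?P W" "distr M ?Q X" ..
  have int_h: "integrable (distr M ?P W \<Otimes>\<^sub>M distr M ?Q X) h"
    using int unfolding joint by (simp add: integrable_distr_eq eq)
  have "(\<integral>\<omega>. inner (\<Psi> (path \<omega>)) (noise (path \<omega>) t i) \<partial>M)
      = integral\<^sup>L (distr M ?P W \<Otimes>\<^sub>M distr M ?Q X) h"
    unfolding joint by (simp add: integral_distr eq)
  also have "\<dots> = (\<integral>w. \<integral>v. h (w, v) \<partial>distr M ?Q X \<partial>distr M ?P W)"
    by (rule PP.integral_fst' [OF int_h, symmetric])
  \<comment> \<open>For fixed \<open>w\<close> only the stochastic gradient varies in the inner
    integral. The fresh sample has law \<open>D i\<close>, so by \<open>dF_eq\<close> its mean is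
    \<open>dF i (u w)\<close>.\<close>
  also have "\<dots> = (\<integral>w. 0 \<partial>distr M ?P W)"
  proof (rule Bochner_Integration.integral_cong [OF refl])
    fix w assume "w \<in> space (distr M ?P W)"
    then have w: "w \<in> space ?P"
      by simp
    interpret Di: prob_space "D i"
      by (rule D_prob_space [OF it(1)])
    let ?k = "\<lambda>z. inner (\<Psi> (\<lambda>k s. w (k, s))) (stoch_grad f (u w) z - dF i (u w))"
    note [measurable] = borel_measurable_integrable [OF stoch_grad_integrable [OF it(1)]]
    have "(\<integral>v. h (w, v) \<partial>distr M ?Q X) = (\<integral>\<omega>. h (w, X \<omega>) \<partial>M)"
      using w by (intro integral_distr X) measurable
    also have "\<dots> = (\<integral>\<omega>. ?k (Z i (Suc t) \<omega>) \<partial>M)"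
      by (simp add: h_def X_def)
    also have "\<dots> = (\<integral>z. ?k z \<partial>distr M (D i) (Z i (Suc t)))"
      by (rule integral_distr [symmetric]) measurable
    also have "\<dots> = 0"
      unfolding distr_Z using stoch_grad_integrable [OF it(1), of "u w"] dF_eq [OF it(1), of "u w"]
      by (simp add: Di.prob_space)
    finally show "(\<integral>v. h (w, v) \<partial>distr M ?Q X) = 0" .
  qed
  finally show ?thesis
    by simp
qed

end

section \<open>Second moments\<close>

text \<open>Used with \<open>h\<close> and \<open>k\<close> the gradients of \<open>F\<close> at
  \<open>xbar\<close> and at \<open>y\<close>, and \<open>G\<close> the mean of the local gradients.
  Polarization of \<open>inner h G\<close> produces \<open>- (norm G)\<^sup>2 / 2\<close>; after the
  term with \<open>u\<close> a weight \<open>(1 - u) / 2\<close> remains, and completing the square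
  with it absorbs \<open>inner (k - h) G\<close>.\<close>

lemma descent_direction_le:
  fixes h k G :: "'a::real_inner"
  assumes "u < 1"
  shows "- inner k G + u / 2 * (norm G)\<^sup>2
    \<le> - (norm h)\<^sup>2 / 2 + (norm (h - G))\<^sup>2 / 2 + (norm (k - h))\<^sup>2 / (2 * (1 - u))"
proof -
  define w where "w = 1 - u"
  have w: "0 < w" "u = 1 - w"
    using assms by (simp_all add: w_def)
  have "0 \<le> (norm (w *\<^sub>R G + (k - h)))\<^sup>2 / (2 * w)"
    using w by simp
  also have "(norm (w *\<^sub>R G + (k - h)))\<^sup>2 = w\<^sup>2 * (norm G)\<^sup>2 + 2 * w * inner (k - h) G + (norm (k - h))\<^sup>2"
    unfolding power2_norm_eq_inner
    by (simp add: inner_add_left inner_add_right inner_diff_left inner_diff_right inner_commute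
        power2_eq_square algebra_simps)
  also have "\<dots> / (2 * w) = w / 2 * (norm G)\<^sup>2 + inner (k - h) G + (norm (k - h))\<^sup>2 / (2 * w)"
    using w by (simp add: add_divide_distrib power2_eq_square)
  finally have "- inner (k - h) G \<le> w / 2 * (norm G)\<^sup>2 + (norm (k - h))\<^sup>2 / (2 * w)"
    by simp
  moreover have "inner h G = ((norm h)\<^sup>2 + (norm G)\<^sup>2 - (norm (h - G))\<^sup>2) / 2"
    by (simp add: power2_norm_eq_inner inner_diff_left inner_diff_right inner_commute)
  ultimately show ?thesis
    unfolding w(2) by (simp add: inner_diff_left left_diff_distrib diff_divide_distrib add_divide_distrib)
qed

context mcser_problem
begin

lemma x_measurable: "i \<in> {1..n} \<Longrightarrow> t \<le> T \<Longrightarrow> (\<lambda>\<omega>. x (path \<omega>) t i) \<in> borel_measurable M"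
  using state_measurable [of D t path M i] stoch_grad_measurable C1 C2 path_measurable by blast

lemma g_path_measurable:
  assumes "i \<in> {1..n}" "t < T"
  shows "(\<lambda>\<omega>. g (path \<omega>) t i) \<in> borel_measurable M"
  using assms
  by (intro g_measurable [of D]) (auto intro!: stoch_grad_measurable C1 C2 path_measurable [of _ _ T])

lemma
  assumes it: "i \<in> {1..n}" "t < T"
  shows noise_sq_integrable: "sq_integrable M (\<lambda>\<omega>. noise (path \<omega>) t i)"
    and noise_bound: "(\<integral>\<omega>. (norm (noise (path \<omega>) t i))\<^sup>2 \<partial>M) \<le> V1"
    and dF_sq_integrable: "sq_integrable M (\<lambda>\<omega>. dF i (x (path \<omega>) t i))"
    and dF_bound: "(\<integral>\<omega>. (norm (dF i (x (path \<omega>) t i)))\<^sup>2 \<partial>M) \<le> V1'"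
proof -
  have t: "Suc t \<in> {1..T}"
    using it by simp
  have b: "integrable M (\<lambda>\<omega>. (norm (noise (path \<omega>) t i))\<^sup>2)"
    "(\<integral>\<omega>. (norm (noise (path \<omega>) t i))\<^sup>2 \<partial>M) \<le> V1"
    "AE \<omega> in M. (norm (dF i (x (path \<omega>) t i)))\<^sup>2 \<le> V1'"
    using bounds [unfolded gradient_bounds_def, rule_format, OF it(1) t] dF_eq [OF it(1)]
    by (simp_all add: mcser_x_eq noise_def g_def dF_def [symmetric] path_def [symmetric] Let_def)
      (simp_all add: path_def)
  have [measurable]: "(\<lambda>\<omega>. dF i (x (path \<omega>) t i)) \<in> borel_measurable M"
    using it measurable_compose [OF x_measurable dF_measurable] by simp
  show dF: "sq_integrable M (\<lambda>\<omega>. dF i (x (path \<omega>) t i))"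
    using b(3) by (intro sq_integrable_dominated [where b = "\<lambda>_. V1'"]) auto
  show "sq_integrable M (\<lambda>\<omega>. noise (path \<omega>) t i)"
    using b(1) g_path_measurable [OF it] by (simp add: sq_integrable_def noise_def)
  show "(\<integral>\<omega>. (norm (noise (path \<omega>) t i))\<^sup>2 \<partial>M) \<le> V1"
    by (rule b(2))
  show "(\<integral>\<omega>. (norm (dF i (x (path \<omega>) t i)))\<^sup>2 \<partial>M) \<le> V1'"
    using integral_mono_AE [OF sq_integrable_integrable [OF dF] integrable_const b(3)]
    by (simp add: prob_space)
qed

lemma V1_nonneg: "0 \<le> V1" and V2_nonneg: "0 \<le> V2"
proof -
  have i: "1 \<in> {1..n}"
    using n_pos by simp
  have "0 \<le> (\<integral>\<omega>. (norm (noise (path \<omega>) 0 1))\<^sup>2 \<partial>M)"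
    "0 \<le> (\<integral>\<omega>. (norm (dF 1 (x (path \<omega>) 0 1)))\<^sup>2 \<partial>M)"
    by simp_all
  then show "0 \<le> V1" "0 \<le> V2"
    using noise_bound [OF i T] dF_bound [OF i T] unfolding V2_def by linarith+
qed

lemma g_eq: "g \<zeta> t i = dF i (x \<zeta> t i) + noise \<zeta> t i"
  by (simp add: noise_def)

lemma others_superset: "t < T \<Longrightarrow> {1..n} \<times> {1..t} \<subseteq> others i t"
  by (auto simp: others_def)

text \<open>The cross term between gradient and noise vanishes: the iterate depends only on samples
  up to \<open>t\<close>, so the gradient there is a function of the samples in
  \<open>others i t\<close>. Hence the two second moments simply add up to
  \<open>V1 + V1'\<close>.\<close>

lemma
  assumes it: "i \<in> {1..n}" "t < T"
  shows g_sq_integrable: "sq_integrable M (\<lambda>\<omega>. g (path \<omega>) t i)"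
    and g_bound: "(\<integral>\<omega>. (norm (g (path \<omega>) t i))\<^sup>2 \<partial>M) \<le> V2"
proof -
  let ?d = "\<lambda>\<omega>. dF i (x (path \<omega>) t i)" and ?N = "\<lambda>\<omega>. noise (path \<omega>) t i"
  note d = dF_sq_integrable [OF it] and N = noise_sq_integrable [OF it]
  show "sq_integrable M (\<lambda>\<omega>. g (path \<omega>) t i)"
    unfolding g_eq by (rule sq_integrable_add [OF d N])
  have int: "integrable M (\<lambda>\<omega>. inner (?d \<omega>) (?N \<omega>))"
    by (rule integrable_inner_sq_integrable [OF d N])
  have "(norm (g (path \<omega>) t i))\<^sup>2 = (norm (?d \<omega>))\<^sup>2 + (norm (?N \<omega>))\<^sup>2 + 2 * inner (?d \<omega>) (?N \<omega>)" for \<omega>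
    unfolding g_eq by (simp add: power2_norm_eq_inner inner_add_left inner_add_right inner_commute)
  then have "(\<integral>\<omega>. (norm (g (path \<omega>) t i))\<^sup>2 \<partial>M)
      = (\<integral>\<omega>. (norm (?d \<omega>))\<^sup>2 \<partial>M) + (\<integral>\<omega>. (norm (?N \<omega>))\<^sup>2 \<partial>M) + 2 * (\<integral>\<omega>. inner (?d \<omega>) (?N \<omega>) \<partial>M)"
    using d N int by (simp add: sq_integrable_def)
  also have "(\<integral>\<omega>. inner (?d \<omega>) (?N \<omega>) \<partial>M) = 0"
    using it others_superset by (intro noise_orthogonal [OF it] int
      path_functional_compose [where k = "dF i"] path_functional_state dF_measurable) auto
  finally show "(\<integral>\<omega>. (norm (g (path \<omega>) t i))\<^sup>2 \<partial>M) \<le> V2"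
    using noise_bound [OF it] dF_bound [OF it] by (simp add: V2_def)
qed

text \<open>\<open>V2 / (1 - \<beta>)\<^sup>2\<close> is the fixed point of
  \<open>s = \<beta> * s + V2 / (1 - \<beta>)\<close>. The vector \<open>u\<close> is kept general
  because the bound is applied twice with the same gradient: to the old momentum, which gives the
  new one, and to the new momentum, which gives \<open>p\<close> up to the factor
  \<open>\<eta>\<close>.\<close>

lemma momentum_average_bound:
  assumes m: "sq_integrable M u" "(\<integral>\<omega>. (norm (u \<omega>))\<^sup>2 \<partial>M) \<le> V2 / (1 - \<beta>)\<^sup>2"
    and it: "i \<in> {1..n}" "t < T"
  shows "sq_integrable M (\<lambda>\<omega>. \<beta> *\<^sub>R u \<omega> + g (path \<omega>) t i) \<and>
    (\<integral>\<omega>. (norm (\<beta> *\<^sub>R u \<omega> + g (path \<omega>) t i))\<^sup>2 \<partial>M) \<le> V2 / (1 - \<beta>)\<^sup>2"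
proof
  note g = g_sq_integrable [OF it]
  show sq: "sq_integrable M (\<lambda>\<omega>. \<beta> *\<^sub>R u \<omega> + g (path \<omega>) t i)"
    by (intro sq_integrable_add sq_integrable_scaleR m g)
  have "(\<integral>\<omega>. (norm (\<beta> *\<^sub>R u \<omega> + g (path \<omega>) t i))\<^sup>2 \<partial>M)
      \<le> (\<integral>\<omega>. \<beta> * (norm (u \<omega>))\<^sup>2 + (norm (g (path \<omega>) t i))\<^sup>2 / (1 - \<beta>) \<partial>M)"
    using sq m(1) g
    by (intro integral_mono norm_sq_convex_le [OF \<beta>0 \<beta>1]) (auto simp: sq_integrable_def)
  also have "\<dots> = \<beta> * (\<integral>\<omega>. (norm (u \<omega>))\<^sup>2 \<partial>M) + (\<integral>\<omega>. (norm (g (path \<omega>) t i))\<^sup>2 \<partial>M) / (1 - \<beta>)"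
    using m(1) g by (simp add: sq_integrable_def)
  also have "\<dots> \<le> \<beta> * (V2 / (1 - \<beta>)\<^sup>2) + V2 / (1 - \<beta>)"
    using m(2) g_bound [OF it] \<beta>0 \<beta>1 by (intro add_mono mult_left_mono divide_right_mono) auto
  also have "\<dots> = V2 / (1 - \<beta>)\<^sup>2"
    using \<beta>1 by (simp add: divide_simps power2_eq_square) (simp add: algebra_simps)
  finally show "(\<integral>\<omega>. (norm (\<beta> *\<^sub>R u \<omega> + g (path \<omega>) t i))\<^sup>2 \<partial>M) \<le> V2 / (1 - \<beta>)\<^sup>2" .
qed

lemma m_bound:
  assumes "i \<in> {1..n}" "t \<le> T"
  shows "sq_integrable M (\<lambda>\<omega>. m (path \<omega>) t i) \<and>
    (\<integral>\<omega>. (norm (m (path \<omega>) t i))\<^sup>2 \<partial>M) \<le> V2 / (1 - \<beta>)\<^sup>2"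
  using assms(2)
proof (induction t)
  case 0
  then show ?case
    using V2_nonneg by (simp add: m_0 sq_integrable_const finite_measure_axioms)
next
  case (Suc t)
  then show ?case
    unfolding m_Suc using assms(1) by (intro momentum_average_bound) auto
qed

lemma
  assumes it: "i \<in> {1..n}" "t < T"
  shows p_sq_integrable: "sq_integrable M (\<lambda>\<omega>. p (path \<omega>) t i)"
    and p_bound: "(\<integral>\<omega>. (norm (p (path \<omega>) t i))\<^sup>2 \<partial>M) \<le> \<eta>\<^sup>2 * (V2 / (1 - \<beta>)\<^sup>2)"
proof -
  have b: "sq_integrable M (\<lambda>\<omega>. \<beta> *\<^sub>R m (path \<omega>) (Suc t) i + g (path \<omega>) t i) \<and>
    (\<integral>\<omega>. (norm (\<beta> *\<^sub>R m (path \<omega>) (Suc t) i + g (path \<omega>) t i))\<^sup>2 \<partial>M) \<le> V2 / (1 - \<beta>)\<^sup>2"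
    using m_bound [OF it(1), of "Suc t"] it by (intro momentum_average_bound) auto
  then show "sq_integrable M (\<lambda>\<omega>. p (path \<omega>) t i)"
    unfolding p_def by (intro sq_integrable_scaleR) simp
  show "(\<integral>\<omega>. (norm (p (path \<omega>) t i))\<^sup>2 \<partial>M) \<le> \<eta>\<^sup>2 * (V2 / (1 - \<beta>)\<^sup>2)"
    unfolding p_def norm_scaleR power_mult_distrib power2_abs integral_mult_right_zero
    using b by (intro mult_left_mono) auto
qed

text \<open>Root mean square bounds for the local errors. \<open>step_error\<close> bounds the
  residual of one compression by \<open>C2\<close>, \<open>contraction\<close> is the factor by
  which passing to the residual of \<open>C1\<close> shrinks the norm, and
  \<open>sync_error\<close>, the bound just after a synchronization, is the fixed point of
  \<open>s = contraction * (s + H * step_error)\<close>.\<close>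

definition step_error where "step_error = sqrt (1 - \<delta>2) * (\<eta> * sqrt V2 / (1 - \<beta>))"
definition contraction where "contraction = sqrt (1 - \<delta>1)"
definition sync_error where
  "sync_error = contraction * (real H * step_error) / (1 - contraction)"

lemma delta_le: "\<delta>1 \<le> 1" "0 \<le> \<delta>2" "\<delta>2 \<le> 1"
  using comp1 comp2 by (auto simp: approx_compressor_def)

lemma contraction: "0 \<le> contraction" "contraction < 1" "contraction\<^sup>2 = 1 - \<delta>1"
  using delta_le \<delta>1 by (auto simp: contraction_def)

lemma step_error: "0 \<le> step_error" "step_error\<^sup>2 = (1 - \<delta>2) * (\<eta>\<^sup>2 * (V2 / (1 - \<beta>)\<^sup>2))"
  using delta_le \<eta> \<beta>1 V2_nonneg by (auto simp: step_error_def power_mult_distrib power_divide)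

lemma sync_error:
  "0 \<le> sync_error" "contraction * (sync_error + real H * step_error) = sync_error"
  using contraction step_error by (auto simp: sync_error_def field_simps)

lemma compressor_error_bound:
  assumes u: "sq_integrable M u" "(\<integral>\<omega>. (norm (u \<omega>))\<^sup>2 \<partial>M) \<le> b"
    and C: "approx_compressor \<delta> C" "C \<in> borel_measurable borel"
  shows "sq_integrable M (\<lambda>\<omega>. u \<omega> - C (u \<omega>))"
    and "(\<integral>\<omega>. (norm (u \<omega> - C (u \<omega>)))\<^sup>2 \<partial>M) \<le> (1 - \<delta>) * b"
proof -
  have [measurable]: "u \<in> borel_measurable M" "C \<in> borel_measurable borel"
    using u C by (auto simp: sq_integrable_def)
  have int: "integrable M (\<lambda>\<omega>. (1 - \<delta>) * (norm (u \<omega>))\<^sup>2)"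
    using u by (auto simp: sq_integrable_def)
  have le: "(norm (v - C v))\<^sup>2 \<le> (1 - \<delta>) * (norm v)\<^sup>2" for v
    using C(1) by (simp add: approx_compressor_def norm_minus_commute)
  show sq: "sq_integrable M (\<lambda>\<omega>. u \<omega> - C (u \<omega>))"
    by (rule sq_integrable_dominated [OF _ int]) (use le in auto)
  have "(\<integral>\<omega>. (norm (u \<omega> - C (u \<omega>)))\<^sup>2 \<partial>M) \<le> (\<integral>\<omega>. (1 - \<delta>) * (norm (u \<omega>))\<^sup>2 \<partial>M)"
    by (intro integral_mono sq_integrable_integrable [OF sq] int le)
  also have "\<dots> \<le> (1 - \<delta>) * b"
    using u(2) C(1) by (simp add: approx_compressor_def mult_left_mono)
  finally show "(\<integral>\<omega>. (norm (u \<omega> - C (u \<omega>)))\<^sup>2 \<partial>M) \<le> (1 - \<delta>) * b" .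
qed

text \<open>\<open>t mod H\<close> counts the iterations since the last synchronization, each adding
  at most \<open>step_error\<close> in mean square norm. After at most \<open>H\<close> of them the
  residual of \<open>C1\<close> contracts the total, and the fixed point equation of
  \<open>sync_error\<close> closes the cycle.\<close>

lemma e_bound:
  assumes "i \<in> {1..n}" "t \<le> T"
  shows "sq_integrable M (\<lambda>\<omega>. e (path \<omega>) t i) \<and>
    (\<integral>\<omega>. (norm (e (path \<omega>) t i))\<^sup>2 \<partial>M) \<le> (sync_error + real (t mod H) * step_error)\<^sup>2"
  using assms(2)
proof (induction t)
  case 0
  then show ?case
    by (simp add: e_0 sq_integrable_const finite_measure_axioms)
next
  case (Suc t)
  let ?b = "sync_error + real (t mod H) * step_error"
  have it: "i \<in> {1..n}" "t < T"
    using assms Suc.prems by auto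
  have IH: "sq_integrable M (\<lambda>\<omega>. e (path \<omega>) t i)" "(\<integral>\<omega>. (norm (e (path \<omega>) t i))\<^sup>2 \<partial>M) \<le> ?b\<^sup>2"
    using Suc by auto
  note r = compressor_error_bound [OF p_sq_integrable [OF it] p_bound [OF it] comp2 C2]
  let ?r = "\<lambda>\<omega>. C2 (p (path \<omega>) t i) - p (path \<omega>) t i"
  have r': "sq_integrable M ?r" "(\<integral>\<omega>. (norm (?r \<omega>))\<^sup>2 \<partial>M) \<le> step_error\<^sup>2"
    using sq_integrable_scaleR [OF r(1), of "-1"] r(2) unfolding step_error(2)
    by (simp_all add: norm_minus_commute)
  have eh_eq: "eh (path \<omega>) t i = e (path \<omega>) t i + ?r \<omega>" for \<omega>
    by (simp add: eh_def)
  have b: "?b + step_error = sync_error + real (Suc (t mod H)) * step_error"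
    by (simp add: algebra_simps)
  have eh: "sq_integrable M (\<lambda>\<omega>. eh (path \<omega>) t i)"
    "(\<integral>\<omega>. (norm (eh (path \<omega>) t i))\<^sup>2 \<partial>M) \<le> (sync_error + real (Suc (t mod H)) * step_error)\<^sup>2"
    unfolding eh_eq b [symmetric]
    by (intro sq_integrable_add norm_sq_add_expectation_le IH r' step_error(1) add_nonneg_nonneg
        sync_error(1) mult_nonneg_nonneg of_nat_0_le_iff)+
  show ?case
  proof (cases "H dvd Suc t")
    case False
    then have "Suc t mod H = Suc (t mod H)"
      unfolding dvd_eq_mod_eq_0 mod_Suc by (simp split: if_splits)
    with False eh show ?thesis
      by (simp add: e_Suc)
  next
    case True
    have "Suc (t mod H) \<le> H"
      using H by (simp add: Suc_leI)
    then have "(sync_error + real (Suc (t mod H)) * step_error)\<^sup>2 \<le> (sync_error + real H * step_error)\<^sup>2"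
      using step_error sync_error by (intro power_mono add_left_mono mult_right_mono) auto
    with eh(2) have le: "(\<integral>\<omega>. (norm (eh (path \<omega>) t i))\<^sup>2 \<partial>M) \<le> (sync_error + real H * step_error)\<^sup>2"
      by linarith
    have "(1 - \<delta>1) * (sync_error + real H * step_error)\<^sup>2 = sync_error\<^sup>2"
      by (metis contraction(3) power_mult_distrib sync_error(2))
    moreover have "Suc t mod H = 0"
      using True by (simp only: dvd_eq_mod_eq_0)
    ultimately show ?thesis
      using True compressor_error_bound [OF eh(1) le comp1 C1] by (simp add: e_Suc)
  qed
qed

definition A where "A = error_const \<delta>1 \<delta>2 H"

lemma A_ge_1: "1 \<le> A"
  using delta_le by (simp add: A_def error_const_def)

text \<open>The origin of \<open>error_const\<close>. The outer factor 2 comes from separating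
  \<open>sync_error\<close> from the local steps. From
  \<open>(1 - contraction) * (1 + contraction) = \<delta>1\<close> follows
  \<open>\<delta>1 \<le> 2 * (1 - contraction)\<close>, which turns the square of
  \<open>sync_error\<close> into \<open>4 * (1 - \<delta>1) / \<delta>1\<^sup>2\<close> times the
  square of \<open>H * step_error\<close>.\<close>

lemma e_bound_uniform:
  assumes "i \<in> {1..n}" "t \<le> T"
  shows "(\<integral>\<omega>. (norm (e (path \<omega>) t i))\<^sup>2 \<partial>M) \<le> (A - 1) * (\<eta>\<^sup>2 * V2 / (1 - \<beta>)\<^sup>2)"
proof -
  let ?b = "real H * step_error"
  have "t mod H \<le> H"
    using H by (simp add: less_imp_le)
  then have "(sync_error + real (t mod H) * step_error)\<^sup>2 \<le> (sync_error + ?b)\<^sup>2"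
    using step_error sync_error by (intro power_mono add_left_mono mult_right_mono) auto
  also have "\<dots> \<le> 2 * sync_error\<^sup>2 + 2 * ?b\<^sup>2"
    using norm_sq_add_le_weighted [of 1 sync_error ?b] by simp
  finally have le: "(sync_error + real (t mod H) * step_error)\<^sup>2 \<le> 2 * sync_error\<^sup>2 + 2 * ?b\<^sup>2" .
  have *: "(1 - contraction) * (1 + contraction) = \<delta>1"
    using contraction(3) by (simp add: power2_eq_square algebra_simps)
  have "(1 - contraction) * (1 + contraction) \<le> (1 - contraction) * 2"
    using contraction(1,2) by (intro mult_left_mono) auto
  then have "\<delta>1 \<le> (1 - contraction) * 2"
    unfolding * .
  then have "\<delta>1\<^sup>2 \<le> ((1 - contraction) * 2)\<^sup>2"
    by (rule power_mono) (use \<delta>1 in simp)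
  then have "\<delta>1\<^sup>2 \<le> (1 - contraction)\<^sup>2 * 4"
    unfolding power_mult_distrib by simp
  then have "1 / (1 - contraction)\<^sup>2 \<le> 4 / \<delta>1\<^sup>2"
    using \<delta>1 contraction(2) by (simp add: divide_simps mult.commute)
  then have "((1 - \<delta>1) * ?b\<^sup>2) * (1 / (1 - contraction)\<^sup>2) \<le> ((1 - \<delta>1) * ?b\<^sup>2) * (4 / \<delta>1\<^sup>2)"
    using delta_le by (intro mult_left_mono) auto
  moreover have "sync_error\<^sup>2 = ((1 - \<delta>1) * ?b\<^sup>2) * (1 / (1 - contraction)\<^sup>2)"
    unfolding sync_error_def power_divide power_mult_distrib [of contraction] contraction(3) by simp
  ultimately have "2 * sync_error\<^sup>2 + 2 * ?b\<^sup>2 \<le> 2 * ((1 - \<delta>1) * ?b\<^sup>2 * (4 / \<delta>1\<^sup>2)) + 2 * ?b\<^sup>2"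
    by linarith
  also have "\<dots> = 2 * (4 * (1 - \<delta>1) / \<delta>1\<^sup>2 + 1) * ?b\<^sup>2"
    using \<delta>1 by (simp add: field_simps)
  also have "\<dots> = (A - 1) * (\<eta>\<^sup>2 * V2 / (1 - \<beta>)\<^sup>2)"
    unfolding power_mult_distrib step_error(2) A_def error_const_def by simp
  finally show ?thesis
    using e_bound [OF assms] le by linarith
qed

section \<open>Integrability along the averaged iterates\<close>

lemma average_m_bound:
  assumes "t \<le> T"
  shows "sq_integrable M (\<lambda>\<omega>. average n (m (path \<omega>) t))"
    and "(\<integral>\<omega>. (norm (average n (m (path \<omega>) t)))\<^sup>2 \<partial>M) \<le> V2 / (1 - \<beta>)\<^sup>2"
proof -
  show "sq_integrable M (\<lambda>\<omega>. average n (m (path \<omega>) t))"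
    using m_bound assms
    by (intro sq_integrable_average [where u = "\<lambda>i \<omega>. m (path \<omega>) t i"] finite_measure_axioms) auto
  show "(\<integral>\<omega>. (norm (average n (m (path \<omega>) t)))\<^sup>2 \<partial>M) \<le> V2 / (1 - \<beta>)\<^sup>2"
    using m_bound assms n_pos
    by (intro norm_sq_average_expectation_le [where u = "\<lambda>i \<omega>. m (path \<omega>) t i"] finite_measure_axioms) auto
qed

lemma y_0: "y \<zeta> 0 = x0"
proof -
  have "average n (x \<zeta> 0) = average n (\<lambda>i. x0)" "average n (m \<zeta> 0) = average n (\<lambda>i. 0)"
    by (intro average_cong x_0 m_0)+
  then show ?thesis
    using n_pos by (simp add: y_def xbar_def average_const)
qed

lemma y_sq_integrable:
  assumes "t \<le> T"
  shows "sq_integrable M (\<lambda>\<omega>. y (path \<omega>) t)"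
  using assms
proof (induction t)
  case 0
  then show ?case
    by (simp add: y_0 sq_integrable_const finite_measure_axioms)
next
  case (Suc t)
  have "sq_integrable M (\<lambda>\<omega>. average n (g (path \<omega>) t))"
    using g_sq_integrable Suc.prems
    by (intro sq_integrable_average [where u = "\<lambda>i \<omega>. g (path \<omega>) t i"] finite_measure_axioms) auto
  with Suc show ?case
    unfolding y_Suc [OF n_pos \<beta>1] by (intro sq_integrable_diff sq_integrable_scaleR) auto
qed

lemma xbar_sq_integrable:
  assumes "t \<le> T"
  shows "sq_integrable M (\<lambda>\<omega>. xbar (path \<omega>) t)"
proof -
  have "xbar \<zeta> t = y \<zeta> t + (\<eta> * \<beta>\<^sup>2 / (1 - \<beta>)) *\<^sub>R average n (m \<zeta> t)" for \<zeta>
    by (simp add: y_def)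
  then show ?thesis
    using sq_integrable_add [OF y_sq_integrable [OF assms]
        sq_integrable_scaleR [OF average_m_bound(1) [OF assms]]] by simp
qed

lemma grad_F_sq_integrable: "sq_integrable M u \<Longrightarrow> sq_integrable M (\<lambda>\<omega>. grad F (u \<omega>))"
  by (rule sq_integrable_Lipschitz [OF finite_measure_axioms _ L_smooth_Lipschitz [OF F_smooth]
        L_smooth_grad_continuous [OF F_smooth]])

text \<open>By the two-sided smoothness bound, \<open>F\<close> differs from its linear
  approximation at 0 by at most a multiple of the squared norm.\<close>

lemma F_integrable:
  assumes "sq_integrable M u"
  shows "integrable M (\<lambda>\<omega>. F (u \<omega>))"
proof -
  have [measurable]: "F \<in> borel_measurable borel"
    by (intro borel_measurable_continuous_onI L_smooth_continuous [OF F_smooth])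
  have [measurable]: "u \<in> borel_measurable M"
    using assms by (rule sq_integrable_measurable)
  have i1: "integrable M (\<lambda>\<omega>. inner (grad F 0) (u \<omega>))"
    by (intro integrable_inner_sq_integrable sq_integrable_const finite_measure_axioms assms)
  have "integrable M (\<lambda>\<omega>. F (u \<omega>) - F 0 - inner (grad F 0) (u \<omega>))"
  proof (rule Bochner_Integration.integrable_bound)
    show "integrable M (\<lambda>\<omega>. L / 2 * (norm (u \<omega>))\<^sup>2)"
      using sq_integrable_integrable [OF assms] by simp
    show "AE \<omega> in M. norm (F (u \<omega>) - F 0 - inner (grad F 0) (u \<omega>)) \<le> norm (L / 2 * (norm (u \<omega>))\<^sup>2)"
      using L_smooth_abs_le [OF F_smooth, of _ 0] L_nonneg by auto
  qed measurable
  from Bochner_Integration.integrable_add [OF this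
      Bochner_Integration.integrable_add [OF i1 integrable_const [of "F 0"]]]
  show ?thesis
    by simp
qed

end

section \<open>Descent\<close>

context mcser_problem
begin

section \<open>Deviation of the gradients from the mean local gradient\<close>

lemma mean_grad_sq_integrable: "t < T \<Longrightarrow> sq_integrable M (\<lambda>\<omega>. mean_grad (path \<omega>) t)"
  unfolding mean_grad_def
  by (intro sq_integrable_average [where u = "\<lambda>i \<omega>. dF i (x (path \<omega>) t i)"] dF_sq_integrable
      finite_measure_axioms)

lemma mean_grad_bound: "t < T \<Longrightarrow> (\<integral>\<omega>. (norm (mean_grad (path \<omega>) t))\<^sup>2 \<partial>M) \<le> V1'"
  unfolding mean_grad_def using n_pos
  by (intro norm_sq_average_expectation_le [where u = "\<lambda>i \<omega>. dF i (x (path \<omega>) t i)"]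
      dF_sq_integrable dF_bound finite_measure_axioms)

lemma norm_grad_F_minus_mean_grad_le:
  "(norm (grad F (xbar \<zeta> t) - mean_grad \<zeta> t))\<^sup>2
    \<le> L\<^sup>2 * ((1 / real n) * (\<Sum>i\<in>{1..n}. (norm (e \<zeta> t i))\<^sup>2))"
proof -
  have "(norm (grad F (xbar \<zeta> t) - mean_grad \<zeta> t))\<^sup>2
      = (norm (average n (\<lambda>i. dF i (xbar \<zeta> t) - dF i (x \<zeta> t i))))\<^sup>2"
    by (simp add: grad_F mean_grad_def average_diff)
  also have "\<dots> \<le> (1 / real n) * (\<Sum>i\<in>{1..n}. (norm (dF i (xbar \<zeta> t) - dF i (x \<zeta> t i)))\<^sup>2)"
    unfolding average_def by (rule norm_sq_average_le)
  also have "\<dots> \<le> (1 / real n) * (\<Sum>i\<in>{1..n}. L\<^sup>2 * (norm (e \<zeta> t i - average n (e \<zeta> t)))\<^sup>2)"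
  proof (intro mult_left_mono sum_mono)
    fix i assume i: "i \<in> {1..n}"
    have "norm (dF i (xbar \<zeta> t) - dF i (x \<zeta> t i)) \<le> L * norm (xbar \<zeta> t - x \<zeta> t i)"
      by (rule dF_Lipschitz [OF i])
    also have "\<dots> = L * norm (e \<zeta> t i - average n (e \<zeta> t))"
      by (simp add: consensus_deviation [OF n_pos, symmetric] norm_minus_commute)
    finally show "(norm (dF i (xbar \<zeta> t) - dF i (x \<zeta> t i)))\<^sup>2 \<le> L\<^sup>2 * (norm (e \<zeta> t i - average n (e \<zeta> t)))\<^sup>2"
      by (metis norm_ge_zero power_mono power_mult_distrib)
  qed simp
  \<comment> \<open>By the variance decomposition, replacing deviations from the average error by
    the errors themselves costs no constant.\<close>
  also have "\<dots> \<le> L\<^sup>2 * ((1 / real n) * (\<Sum>i\<in>{1..n}. (norm (e \<zeta> t i))\<^sup>2))"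
  proof -
    have "(\<Sum>i\<in>{1..n}. (norm (e \<zeta> t i - average n (e \<zeta> t)))\<^sup>2) \<le> (\<Sum>i\<in>{1..n}. (norm (e \<zeta> t i))\<^sup>2)"
      unfolding average_def by (subst sum_norm_sq_deviation [OF n_pos]) simp
    then have "L\<^sup>2 * ((1 / real n) * (\<Sum>i\<in>{1..n}. (norm (e \<zeta> t i - average n (e \<zeta> t)))\<^sup>2))
        \<le> L\<^sup>2 * ((1 / real n) * (\<Sum>i\<in>{1..n}. (norm (e \<zeta> t i))\<^sup>2))"
      by (intro mult_left_mono) auto
    then show ?thesis
      by (simp add: sum_distrib_left [symmetric] mult.left_commute)
  qed
  finally show ?thesis .
qed

lemma
  assumes t: "t < T"
  shows grad_deviation_sq_integrable:
      "sq_integrable M (\<lambda>\<omega>. grad F (xbar (path \<omega>) t) - mean_grad (path \<omega>) t)"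
    and grad_deviation_bound:
      "(\<integral>\<omega>. (norm (grad F (xbar (path \<omega>) t) - mean_grad (path \<omega>) t))\<^sup>2 \<partial>M)
        \<le> L\<^sup>2 * ((A - 1) * (\<eta>\<^sup>2 * V2 / (1 - \<beta>)\<^sup>2))"
proof -
  show sq: "sq_integrable M (\<lambda>\<omega>. grad F (xbar (path \<omega>) t) - mean_grad (path \<omega>) t)"
    using t by (intro sq_integrable_diff grad_F_sq_integrable xbar_sq_integrable mean_grad_sq_integrable) auto
  have e: "integrable M (\<lambda>\<omega>. (norm (e (path \<omega>) t i))\<^sup>2)" if "i \<in> {1..n}" for i
    using e_bound [OF that, of t] t by (simp add: sq_integrable_integrable)
  have "(\<integral>\<omega>. (norm (grad F (xbar (path \<omega>) t) - mean_grad (path \<omega>) t))\<^sup>2 \<partial>M)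
      \<le> (\<integral>\<omega>. L\<^sup>2 * ((1 / real n) * (\<Sum>i\<in>{1..n}. (norm (e (path \<omega>) t i))\<^sup>2)) \<partial>M)"
    by (intro integral_mono sq_integrable_integrable [OF sq] norm_grad_F_minus_mean_grad_le
        integrable_mult_right Bochner_Integration.integrable_sum e)
  also have "\<dots> = L\<^sup>2 * ((1 / real n) * (\<Sum>i\<in>{1..n}. \<integral>\<omega>. (norm (e (path \<omega>) t i))\<^sup>2 \<partial>M))"
    by (subst integral_mult_right_zero, subst integral_mult_right_zero,
        subst Bochner_Integration.integral_sum) (auto intro: e)
  also have "\<dots> \<le> L\<^sup>2 * ((1 / real n) * (\<Sum>i\<in>{1..n}. (A - 1) * (\<eta>\<^sup>2 * V2 / (1 - \<beta>)\<^sup>2)))"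
    using t by (intro mult_left_mono sum_mono e_bound_uniform) auto
  also have "\<dots> = L\<^sup>2 * ((A - 1) * (\<eta>\<^sup>2 * V2 / (1 - \<beta>)\<^sup>2))"
    using n_pos by simp
  finally show "(\<integral>\<omega>. (norm (grad F (xbar (path \<omega>) t) - mean_grad (path \<omega>) t))\<^sup>2 \<partial>M)
        \<le> L\<^sup>2 * ((A - 1) * (\<eta>\<^sup>2 * V2 / (1 - \<beta>)\<^sup>2))" .
qed

lemma
  assumes t: "t < T"
  shows grad_shift_sq_integrable:
      "sq_integrable M (\<lambda>\<omega>. grad F (y (path \<omega>) t) - grad F (xbar (path \<omega>) t))"
    and grad_shift_bound:
      "(\<integral>\<omega>. (norm (grad F (y (path \<omega>) t) - grad F (xbar (path \<omega>) t)))\<^sup>2 \<partial>M)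
        \<le> L\<^sup>2 * ((\<eta> * \<beta>\<^sup>2 / (1 - \<beta>))\<^sup>2 * (V2 / (1 - \<beta>)\<^sup>2))"
proof -
  let ?c = "\<eta> * \<beta>\<^sup>2 / (1 - \<beta>)"
  have tT: "t \<le> T"
    using t by simp
  show sq: "sq_integrable M (\<lambda>\<omega>. grad F (y (path \<omega>) t) - grad F (xbar (path \<omega>) t))"
    using t by (intro sq_integrable_diff grad_F_sq_integrable xbar_sq_integrable y_sq_integrable) auto
  have le: "(norm (grad F (y \<zeta> t) - grad F (xbar \<zeta> t)))\<^sup>2
      \<le> L\<^sup>2 * (?c\<^sup>2 * (norm (average n (m \<zeta> t)))\<^sup>2)" for \<zeta>
    using power_mono [OF L_smooth_Lipschitz [OF F_smooth, of "y \<zeta> t" "xbar \<zeta> t"] norm_ge_zero, where n = 2]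
    unfolding y_minus_xbar power_mult_distrib power2_abs .
  have "(\<integral>\<omega>. (norm (grad F (y (path \<omega>) t) - grad F (xbar (path \<omega>) t)))\<^sup>2 \<partial>M)
      \<le> (\<integral>\<omega>. L\<^sup>2 * (?c\<^sup>2 * (norm (average n (m (path \<omega>) t)))\<^sup>2) \<partial>M)"
    using average_m_bound(1) [OF tT]
    by (intro integral_mono sq_integrable_integrable [OF sq] le integrable_mult_right)
      (rule sq_integrable_integrable)
  also have "\<dots> \<le> L\<^sup>2 * (?c\<^sup>2 * (V2 / (1 - \<beta>)\<^sup>2))"
    unfolding integral_mult_right_zero
    using average_m_bound(2) [OF tT] by (intro mult_left_mono) auto
  finally show "(\<integral>\<omega>. (norm (grad F (y (path \<omega>) t) - grad F (xbar (path \<omega>) t)))\<^sup>2 \<partial>M)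
        \<le> L\<^sup>2 * (?c\<^sup>2 * (V2 / (1 - \<beta>)\<^sup>2))" .
qed

section \<open>The averaged noise and the descent inequality\<close>

definition mean_noise where "mean_noise \<zeta> t = average n (noise \<zeta> t)"

lemma average_g: "average n (g \<zeta> t) = mean_grad \<zeta> t + mean_noise \<zeta> t"
proof -
  have "average n (g \<zeta> t) = average n (\<lambda>i. dF i (x \<zeta> t i) + noise \<zeta> t i)"
    by (rule average_cong) (rule g_eq)
  then show ?thesis
    by (simp add: average_add mean_grad_def mean_noise_def)
qed

lemma mean_noise_sq_integrable: "t < T \<Longrightarrow> sq_integrable M (\<lambda>\<omega>. mean_noise (path \<omega>) t)"
  unfolding mean_noise_def
  by (intro sq_integrable_average [where u = "\<lambda>i \<omega>. noise (path \<omega>) t i"] noise_sq_integrable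
      finite_measure_axioms)

lemma path_functional_noise:
  assumes "{1..n} \<times> {1..t} \<subseteq> J" "j \<in> {1..n}" "(j, Suc t) \<in> J"
  shows "path_functional J (\<lambda>\<zeta>. noise \<zeta> t j)"
  unfolding noise_def using assms
  by (intro path_functional_diff path_functional_g path_functional_compose [where k = "dF j"]
      path_functional_state dF_measurable)

text \<open>The source of the factor \<open>1 / n\<close>: of the \<open>n * n\<close> inner
  products only the \<open>n\<close> diagonal ones have nonzero mean.\<close>

lemma mean_noise_bound:
  assumes t: "t < T"
  shows "(\<integral>\<omega>. (norm (mean_noise (path \<omega>) t))\<^sup>2 \<partial>M) \<le> V1 / real n"
proof -
  let ?N = "\<lambda>i \<omega>. noise (path \<omega>) t i"
  have int: "integrable M (\<lambda>\<omega>. inner (?N i \<omega>) (?N j \<omega>))" if "i \<in> {1..n}" "j \<in> {1..n}" for i j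
    using t that by (intro integrable_inner_sq_integrable noise_sq_integrable)
  have cross: "(\<integral>\<omega>. inner (?N i \<omega>) (?N j \<omega>) \<partial>M) = (if i = j then \<integral>\<omega>. (norm (?N i \<omega>))\<^sup>2 \<partial>M else 0)"
    if ij: "i \<in> {1..n}" "j \<in> {1..n}" for i j
  proof (cases "i = j")
    case False
    \<comment> \<open>The sample used by another worker in the same iteration is among the others of
      worker \<open>j\<close>, so the noise of worker \<open>i\<close> is an admissible test
      function.\<close>
    have "(i, Suc t) \<in> others j t"
      using t ij False by (auto simp: others_def)
    then show ?thesis
      using False noise_orthogonal [OF ij(2) t path_functional_noise [OF others_superset [OF t] ij(1)] int [OF ij]]
      by simp
  qed (simp add: power2_norm_eq_inner)
  have "(\<integral>\<omega>. (norm (mean_noise (path \<omega>) t))\<^sup>2 \<partial>M)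
      = (1 / (real n)\<^sup>2) * (\<Sum>i\<in>{1..n}. \<Sum>j\<in>{1..n}. \<integral>\<omega>. inner (?N i \<omega>) (?N j \<omega>) \<partial>M)"
  proof -
    have "(\<integral>\<omega>. (\<Sum>i\<in>{1..n}. \<Sum>j\<in>{1..n}. inner (?N i \<omega>) (?N j \<omega>)) \<partial>M)
        = (\<Sum>i\<in>{1..n}. \<integral>\<omega>. (\<Sum>j\<in>{1..n}. inner (?N i \<omega>) (?N j \<omega>)) \<partial>M)"
      by (intro Bochner_Integration.integral_sum Bochner_Integration.integrable_sum int)
    also have "\<dots> = (\<Sum>i\<in>{1..n}. \<Sum>j\<in>{1..n}. \<integral>\<omega>. inner (?N i \<omega>) (?N j \<omega>) \<partial>M)"
      by (intro sum.cong refl Bochner_Integration.integral_sum int)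
    finally show ?thesis
      by (simp only: mean_noise_def norm_sq_average_eq integral_mult_right_zero)
  qed
  also have "\<dots> = (1 / (real n)\<^sup>2) * (\<Sum>i\<in>{1..n}. \<integral>\<omega>. (norm (?N i \<omega>))\<^sup>2 \<partial>M)"
    by (simp add: cross)
  also have "\<dots> \<le> (1 / (real n)\<^sup>2) * (\<Sum>i\<in>{1..n}. V1)"
    using t by (intro mult_left_mono sum_mono noise_bound) auto
  also have "\<dots> = V1 / real n"
    using n_pos by (simp add: power2_eq_square)
  finally show ?thesis .
qed

lemma mean_noise_orthogonal:
  assumes t: "t < T" and \<Psi>: "\<And>i. i \<in> {1..n} \<Longrightarrow> path_functional (others i t) \<Psi>"
    and sq: "sq_integrable M (\<lambda>\<omega>. \<Psi> (path \<omega>))"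
  shows "(\<integral>\<omega>. inner (\<Psi> (path \<omega>)) (mean_noise (path \<omega>) t) \<partial>M) = 0"
proof -
  have int: "integrable M (\<lambda>\<omega>. inner (\<Psi> (path \<omega>)) (noise (path \<omega>) t i))" if "i \<in> {1..n}" for i
    by (intro integrable_inner_sq_integrable sq noise_sq_integrable that t)
  have "(\<integral>\<omega>. inner (\<Psi> (path \<omega>)) (mean_noise (path \<omega>) t) \<partial>M)
      = (1 / real n) * (\<Sum>i\<in>{1..n}. \<integral>\<omega>. inner (\<Psi> (path \<omega>)) (noise (path \<omega>) t i) \<partial>M)"
    using int unfolding mean_noise_def average_def inner_scaleR_right inner_sum_right integral_mult_right_zero
    by (subst Bochner_Integration.integral_sum) auto
  also have "\<dots> = 0"
    using noise_orthogonal [OF _ t \<Psi> int] by simp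
  finally show ?thesis .
qed

text \<open>Smoothness is applied to the step \<open>- a *\<^sub>R (G + N)\<close>. Both the
  gradient at \<open>y\<close> and \<open>G\<close> are functions of samples up to \<open>t\<close>,
  hence orthogonal to the noise \<open>N\<close>, which survives only through its second
  moment.\<close>

lemma descent_step:
  assumes t: "t < T"
  defines "a \<equiv> \<eta> / (1 - \<beta>)"
  shows "(\<integral>\<omega>. F (y (path \<omega>) (Suc t)) \<partial>M) \<le> (\<integral>\<omega>. F (y (path \<omega>) t) \<partial>M)
    + a * (\<integral>\<omega>. - inner (grad F (y (path \<omega>) t)) (mean_grad (path \<omega>) t)
               + L * a / 2 * (norm (mean_grad (path \<omega>) t))\<^sup>2 \<partial>M) + L * a\<^sup>2 / 2 * (V1 / real n)"
proof -
  let ?k = "\<lambda>\<omega>. grad F (y (path \<omega>) t)" and ?G = "\<lambda>\<omega>. mean_grad (path \<omega>) t"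
    and ?N = "\<lambda>\<omega>. mean_noise (path \<omega>) t"
  have sub: "{1..n} \<times> {1..t} \<subseteq> others i t" for i
    using others_superset [OF t] .
  have Fy: "integrable M (\<lambda>\<omega>. F (y (path \<omega>) t))" "integrable M (\<lambda>\<omega>. F (y (path \<omega>) (Suc t)))"
    by (intro F_integrable y_sq_integrable; use t in simp)+
  have k: "sq_integrable M ?k"
    by (intro grad_F_sq_integrable y_sq_integrable) (use t in simp)
  note G = mean_grad_sq_integrable [OF t] and N = mean_noise_sq_integrable [OF t]
  note ints = Fy integrable_inner_sq_integrable [OF k G] integrable_inner_sq_integrable [OF k N]
    integrable_inner_sq_integrable [OF G N] sq_integrable_integrable [OF G] sq_integrable_integrable [OF N]
  have kN: "(\<integral>\<omega>. inner (?k \<omega>) (?N \<omega>) \<partial>M) = 0"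
    by (intro mean_noise_orthogonal [OF t _ k] path_functional_compose [OF path_functional_y [OF sub]]
        grad_F_measurable)
  have GN: "(\<integral>\<omega>. inner (?G \<omega>) (?N \<omega>) \<partial>M) = 0"
  proof (rule mean_noise_orthogonal [OF t _ G])
    show "path_functional (others i t) (\<lambda>\<zeta>. mean_grad \<zeta> t)" for i
      unfolding mean_grad_def
      by (intro path_functional_average path_functional_compose [OF path_functional_state [OF sub]]
          dF_measurable)
  qed
  have step: "F (y (path \<omega>) (Suc t)) \<le> F (y (path \<omega>) t)
      + a * (- inner (?k \<omega>) (?G \<omega>) + L * a / 2 * (norm (?G \<omega>))\<^sup>2)
      + (L * a\<^sup>2 / 2 * (norm (?N \<omega>))\<^sup>2 + (- a) * inner (?k \<omega>) (?N \<omega>) + L * a\<^sup>2 * inner (?G \<omega>) (?N \<omega>))" for \<omega>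
  proof -
    have d: "y (path \<omega>) (Suc t) - y (path \<omega>) t = - a *\<^sub>R (?G \<omega> + ?N \<omega>)"
      unfolding y_Suc [OF n_pos \<beta>1] average_g a_def by simp
    have "F (y (path \<omega>) (Suc t)) \<le> F (y (path \<omega>) t) + inner (?k \<omega>) (- a *\<^sub>R (?G \<omega> + ?N \<omega>))
        + L / 2 * (norm (- a *\<^sub>R (?G \<omega> + ?N \<omega>)))\<^sup>2"
      using L_smooth_abs_le [OF F_smooth, of "y (path \<omega>) (Suc t)" "y (path \<omega>) t"] unfolding d by linarith
    also have "(norm (- a *\<^sub>R (?G \<omega> + ?N \<omega>)))\<^sup>2
        = a\<^sup>2 * ((norm (?G \<omega>))\<^sup>2 + 2 * inner (?G \<omega>) (?N \<omega>) + (norm (?N \<omega>))\<^sup>2)"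
      unfolding norm_scaleR power_mult_distrib
      by (simp add: power2_norm_eq_inner inner_add_left inner_add_right inner_commute)
    finally show ?thesis
      by (simp add: inner_add_right algebra_simps power2_eq_square)
  qed
  have "(\<integral>\<omega>. F (y (path \<omega>) (Suc t)) \<partial>M) \<le> (\<integral>\<omega>. F (y (path \<omega>) t)
      + a * (- inner (?k \<omega>) (?G \<omega>) + L * a / 2 * (norm (?G \<omega>))\<^sup>2)
      + (L * a\<^sup>2 / 2 * (norm (?N \<omega>))\<^sup>2 + (- a) * inner (?k \<omega>) (?N \<omega>) + L * a\<^sup>2 * inner (?G \<omega>) (?N \<omega>)) \<partial>M)"
    by (intro integral_mono step ints Bochner_Integration.integrable_add integrable_mult_right
        Bochner_Integration.integrable_minus)
  also have "\<dots> = (\<integral>\<omega>. F (y (path \<omega>) t) \<partial>M)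
      + a * (\<integral>\<omega>. - inner (?k \<omega>) (?G \<omega>) + L * a / 2 * (norm (?G \<omega>))\<^sup>2 \<partial>M)
      + (L * a\<^sup>2 / 2 * (\<integral>\<omega>. (norm (?N \<omega>))\<^sup>2 \<partial>M) + (- a) * (\<integral>\<omega>. inner (?k \<omega>) (?N \<omega>) \<partial>M)
         + L * a\<^sup>2 * (\<integral>\<omega>. inner (?G \<omega>) (?N \<omega>) \<partial>M))"
    using ints by simp
  also have "\<dots> \<le> (\<integral>\<omega>. F (y (path \<omega>) t) \<partial>M)
      + a * (\<integral>\<omega>. - inner (?k \<omega>) (?G \<omega>) + L * a / 2 * (norm (?G \<omega>))\<^sup>2 \<partial>M) + L * a\<^sup>2 / 2 * (V1 / real n)"
    unfolding kN GN using mult_left_mono [OF mean_noise_bound [OF t], of "L * a\<^sup>2 / 2"] L_nonneg by simp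
  finally show ?thesis .
qed

lemma grad_norm_integrable:
  "t \<le> T \<Longrightarrow> integrable M (\<lambda>\<omega>. (norm (grad F (xbar (path \<omega>) t)))\<^sup>2)"
  by (intro sq_integrable_integrable grad_F_sq_integrable xbar_sq_integrable)

text \<open>The common unit for both error terms: the momentum shift costs at most
  \<open>\<beta> ^ 4 * drift\<close> before division by the remaining weight of the mean gradient,
  the local errors at most \<open>(A - 1) * drift\<close>.\<close>

definition drift where "drift = \<eta>\<^sup>2 * L\<^sup>2 * V2 / (1 - \<beta>) ^ 4"

lemma drift_nonneg: "0 \<le> drift"
  using V2_nonneg \<beta>1 by (simp add: drift_def)

text \<open>For small \<open>L * \<eta> / (1 - \<beta>)\<close> the quadratic term of the descent inequality leaves enough of
  the squared mean gradient to absorb the momentum shift. Otherwise \<open>A * drift\<close> already dominates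
  the second moment of the gradient.\<close>

lemma grad_norm_step:
  assumes t: "t < T" and small: "\<beta> ^ 4 \<le> 1 - L * (\<eta> / (1 - \<beta>))" and lt1: "L * (\<eta> / (1 - \<beta>)) < 1"
  shows "(\<integral>\<omega>. (norm (grad F (xbar (path \<omega>) t)))\<^sup>2 \<partial>M)
    \<le> 2 * (1 - \<beta>) / \<eta> * ((\<integral>\<omega>. F (y (path \<omega>) t) \<partial>M) - (\<integral>\<omega>. F (y (path \<omega>) (Suc t)) \<partial>M))
      + L * \<eta> * V1 / (real n * (1 - \<beta>)) + A * drift"
proof -
  define a where "a = \<eta> / (1 - \<beta>)"
  define u where "u = L * a"
  have a: "0 < a"
    using \<eta> \<beta>1 by (simp add: a_def)
  have u: "\<beta> ^ 4 \<le> 1 - u" "u < 1"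
    using small lt1 by (simp_all add: u_def a_def)
  let ?h = "\<lambda>\<omega>. grad F (xbar (path \<omega>) t)" and ?k = "\<lambda>\<omega>. grad F (y (path \<omega>) t)"
    and ?G = "\<lambda>\<omega>. mean_grad (path \<omega>) t"
  define P where "P = (\<integral>\<omega>. (norm (?h \<omega>))\<^sup>2 \<partial>M)"
  define Q where "Q = (\<integral>\<omega>. (norm (?h \<omega> - ?G \<omega>))\<^sup>2 \<partial>M)"
  define R where "R = (\<integral>\<omega>. (norm (?k \<omega> - ?h \<omega>))\<^sup>2 \<partial>M)"
  have k: "sq_integrable M ?k"
    by (intro grad_F_sq_integrable y_sq_integrable) (use t in simp)
  note G = mean_grad_sq_integrable [OF t]
  note ints = integrable_inner_sq_integrable [OF k G] sq_integrable_integrable [OF G]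
    grad_norm_integrable [OF less_imp_le [OF t]]
    sq_integrable_integrable [OF grad_deviation_sq_integrable [OF t]]
    sq_integrable_integrable [OF grad_shift_sq_integrable [OF t]]
  have "(\<integral>\<omega>. - inner (?k \<omega>) (?G \<omega>) + u / 2 * (norm (?G \<omega>))\<^sup>2 \<partial>M)
      \<le> (\<integral>\<omega>. - (norm (?h \<omega>))\<^sup>2 / 2 + (norm (?h \<omega> - ?G \<omega>))\<^sup>2 / 2
            + (norm (?k \<omega> - ?h \<omega>))\<^sup>2 / (2 * (1 - u)) \<partial>M)"
    by (intro integral_mono descent_direction_le [OF u(2)] ints Bochner_Integration.integrable_add
        integrable_mult_right Bochner_Integration.integrable_minus integrable_divide)
  also have "\<dots> = - P / 2 + Q / 2 + R / (2 * (1 - u))"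
    unfolding P_def Q_def R_def using ints by simp
  finally have dir: "(\<integral>\<omega>. - inner (?k \<omega>) (?G \<omega>) + L * a / 2 * (norm (?G \<omega>))\<^sup>2 \<partial>M)
      \<le> - P / 2 + Q / 2 + R / (1 - u) / 2"
    by (simp add: u_def divide_divide_eq_left mult.commute)
  define E where "E s = (\<integral>\<omega>. F (y (path \<omega>) s) \<partial>M)" for s
  define v where "v = V1 / real n"
  define R' where "R' = R / (1 - u)"
  have "E (Suc t) \<le> E t + a * (- P / 2 + Q / 2 + R' / 2) + L * a\<^sup>2 / 2 * v"
    using descent_step [OF t] mult_left_mono [OF dir less_imp_le [OF a]] unfolding a_def [symmetric] E_def
      v_def R'_def by linarith
  then have "a * P \<le> 2 * (E t - E (Suc t)) + a * (Q + R') + a * (L * a * v)"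
    by (simp add: algebra_simps power2_eq_square)
  also have "\<dots> = a * (2 / a * (E t - E (Suc t)) + (Q + R') + L * a * v)"
    using a by (simp add: distrib_left)
  finally have P: "P \<le> 2 / a * (E t - E (Suc t)) + (Q + R / (1 - u)) + L * a * (V1 / real n)"
    using a by (simp add: v_def R'_def)
  have w: "0 < 1 - \<beta>" "1 - \<beta> \<le> 1"
    using \<beta>0 \<beta>1 by auto
  have "Q \<le> (A - 1) * drift"
  proof -
    \<comment> \<open>The bound for the local errors has only the second power of
      \<open>1 - \<beta>\<close> in the denominator; it is weakened to match
      \<open>drift\<close>.\<close>
    have "V2 / (1 - \<beta>)\<^sup>2 \<le> V2 / (1 - \<beta>) ^ 4"
      using w V2_nonneg by (intro divide_left_mono) (auto intro: power_decreasing)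
    then have "L\<^sup>2 * ((A - 1) * (\<eta>\<^sup>2 * (V2 / (1 - \<beta>)\<^sup>2))) \<le> L\<^sup>2 * ((A - 1) * (\<eta>\<^sup>2 * (V2 / (1 - \<beta>) ^ 4)))"
      using A_ge_1 by (intro mult_left_mono) auto
    also have "\<dots> = (A - 1) * drift"
      by (simp add: drift_def)
    finally show ?thesis
      using grad_deviation_bound [OF t] by (simp add: Q_def)
  qed
  moreover have "R / (1 - u) \<le> drift"
  proof -
    \<comment> \<open>The factor \<open>\<beta> ^ 4\<close> is the square of the
      \<open>\<beta>\<^sup>2\<close> in the shift from \<open>xbar\<close> to \<open>y\<close>. It
      is exactly what the smallness assumption cancels against the division by
      \<open>1 - u\<close>.\<close>
    have "R \<le> \<beta> ^ 4 * drift"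
      using grad_shift_bound [OF t]
      by (simp add: R_def drift_def power_mult_distrib power_divide power2_eq_square power4_eq_xxxx mult_ac)
    also have "\<dots> \<le> (1 - u) * drift"
      using u drift_nonneg by (intro mult_right_mono)
    finally show ?thesis
      using u by (simp add: pos_divide_le_eq mult.commute)
  qed
  ultimately have "P \<le> 2 / a * (E t - E (Suc t)) + A * drift + L * a * (V1 / real n)"
    using P by (simp add: algebra_simps)
  moreover have "2 / a = 2 * (1 - \<beta>) / \<eta>" "L * a * (V1 / real n) = L * \<eta> * V1 / (real n * (1 - \<beta>))"
    by (simp_all add: a_def mult.commute)
  ultimately show ?thesis
    by (simp add: P_def E_def)
qed

text \<open>The gradient is split into the mean gradient and its deviation, of root mean square at
  most \<open>r\<close> and \<open>u * q * r\<close> with \<open>r\<^sup>2 = V2\<close> and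
  \<open>q\<^sup>2 = A - 1\<close>. Cauchy-Schwarz bounds \<open>(1 + u * q)\<^sup>2\<close> by
  \<open>(1 + u\<^sup>2) * A\<close>. As \<open>A * drift\<close> equals
  \<open>u\<^sup>2 / w\<^sup>2 * A * V2\<close>, it remains to show
  \<open>1 + u\<^sup>2 \<le> u\<^sup>2 / w\<^sup>2\<close>.\<close>

lemma grad_norm_large_step:
  assumes t: "t < T" and large: "1 - L * (\<eta> / (1 - \<beta>)) < \<beta> ^ 4" and le: "L * (\<eta> / (1 - \<beta>)) \<le> 1 / 2"
  shows "(\<integral>\<omega>. (norm (grad F (xbar (path \<omega>) t)))\<^sup>2 \<partial>M) \<le> A * drift"
proof -
  define u where "u = L * (\<eta> / (1 - \<beta>))"
  define w where "w = 1 - \<beta>"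
  have u: "1 - u < \<beta> ^ 4" "u \<le> 1 / 2" "0 \<le> u"
    using large le L_nonneg \<eta> \<beta>1 by (simp_all add: u_def)
  have w: "0 < w"
    using \<beta>1 by (simp add: w_def)
  have u2: "u\<^sup>2 = L\<^sup>2 * \<eta>\<^sup>2 / w\<^sup>2"
    by (simp add: u_def w_def power_mult_distrib power_divide)
  let ?h = "\<lambda>\<omega>. grad F (xbar (path \<omega>) t)" and ?G = "\<lambda>\<omega>. mean_grad (path \<omega>) t"
  define r where "r = sqrt V2"
  define q where "q = sqrt (A - 1)"
  have r: "r\<^sup>2 = V2" "0 \<le> r" and q: "q\<^sup>2 = A - 1" "0 \<le> q"
    using V2_nonneg A_ge_1 by (simp_all add: r_def q_def)
  have "(\<integral>\<omega>. (norm (?h \<omega>))\<^sup>2 \<partial>M) = (\<integral>\<omega>. (norm (?G \<omega> + (?h \<omega> - ?G \<omega>)))\<^sup>2 \<partial>M)"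
    by simp
  also have "\<dots> \<le> (r + u * q * r)\<^sup>2"
  proof (intro norm_sq_add_expectation_le mean_grad_sq_integrable grad_deviation_sq_integrable t)
    show "(\<integral>\<omega>. (norm (?G \<omega>))\<^sup>2 \<partial>M) \<le> r\<^sup>2"
      using mean_grad_bound [OF t] V1_nonneg by (simp add: r V2_def)
    show "(\<integral>\<omega>. (norm (?h \<omega> - ?G \<omega>))\<^sup>2 \<partial>M) \<le> (u * q * r)\<^sup>2"
      using grad_deviation_bound [OF t] by (simp add: power_mult_distrib u2 q r w_def mult_ac)
  qed (use r q u in auto)
  also have "\<dots> \<le> (1 + u\<^sup>2) * (1 + q\<^sup>2) * r\<^sup>2"
  proof -
    have "(1 + u * q)\<^sup>2 \<le> (1 + u\<^sup>2) * (1 + q\<^sup>2)"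
      using zero_le_power2 [of "u - q"] by (simp add: power2_eq_square algebra_simps)
    then have "(1 + u * q)\<^sup>2 * r\<^sup>2 \<le> (1 + u\<^sup>2) * (1 + q\<^sup>2) * r\<^sup>2"
      by (intro mult_right_mono) auto
    then show ?thesis
      by (simp add: power2_eq_square algebra_simps)
  qed
  also have "\<dots> \<le> u\<^sup>2 / w\<^sup>2 * (1 + q\<^sup>2) * r\<^sup>2"
  proof -
    \<comment> \<open>\<open>u \<le> 1 / 2\<close> forces \<open>\<beta> ^ 4 > 1 / 2\<close>, so
      momentum is heavy. Then \<open>1 - \<beta> ^ 4\<close>, which is
      \<open>w * (1 + \<beta>) * (1 + \<beta>\<^sup>2)\<close>, is at least \<open>2 * w\<close>,
      and \<open>u\<close> exceeds it.\<close>
    have b2: "\<beta>\<^sup>2 \<ge> 1 / 2"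
    proof -
      have "\<beta> ^ 4 \<le> \<beta>\<^sup>2"
        using \<beta>0 \<beta>1 by (intro power_decreasing) auto
      then show ?thesis
        using u by linarith
    qed
    have b1: "\<beta> \<ge> 1 / 2"
    proof -
      have "\<beta>\<^sup>2 \<le> \<beta>"
        using \<beta>0 \<beta>1 mult_left_mono [of \<beta> 1 \<beta>] by (simp add: power2_eq_square)
      then show ?thesis
        using b2 by linarith
    qed
    have "w * 2 \<le> w * ((1 + \<beta>) * (1 + \<beta>\<^sup>2))"
    proof (intro mult_left_mono)
      have "(1 + 1 / 2) * (1 + 1 / 2) \<le> (1 + \<beta>) * (1 + \<beta>\<^sup>2)"
        using b1 b2 by (intro mult_mono) auto
      then show "2 \<le> (1 + \<beta>) * (1 + \<beta>\<^sup>2)"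
        by simp
    qed (use w in simp)
    also have "\<dots> = 1 - \<beta> ^ 4"
      by (simp add: w_def power2_eq_square power4_eq_xxxx algebra_simps)
    finally have uw: "2 * w \<le> u"
      using u by linarith
    have "(2 * w)\<^sup>2 \<le> u\<^sup>2" "w\<^sup>2 \<le> (1 / 4)\<^sup>2"
      using uw u w by (intro power_mono; linarith)+
    then have "4 * w\<^sup>2 \<le> u\<^sup>2" "w\<^sup>2 \<le> 1 / 16"
      by (simp_all add: power_mult_distrib power_divide)
    moreover from this have "w\<^sup>2 * u\<^sup>2 \<le> 1 / 16 * u\<^sup>2"
      by (intro mult_right_mono) auto
    ultimately have "w\<^sup>2 * (1 + u\<^sup>2) \<le> u\<^sup>2"
      using zero_le_power2 [of u] unfolding distrib_left by linarith
    then have "1 + u\<^sup>2 \<le> u\<^sup>2 / w\<^sup>2"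
      using w by (simp add: pos_le_divide_eq mult.commute)
    then show ?thesis
      by (intro mult_right_mono) auto
  qed
  also have "\<dots> = A * drift"
    unfolding q r u2 drift_def w_def [symmetric]
    by (simp add: power2_eq_square power4_eq_xxxx mult_ac)
  finally show ?thesis .
qed

text \<open>The case distinction does not depend on the iteration, so a whole run falls into one
  case. In the first the values of \<open>F\<close> at \<open>y\<close> telescope, starting at
  \<open>x0\<close> and ending no lower than \<open>F xstar\<close>.\<close>

theorem grad_norm_average:
  assumes le: "L * (\<eta> / (1 - \<beta>)) \<le> 1 / 2"
  shows "(1 / real T) * (\<Sum>t\<in>{1..T}. \<integral>\<omega>. (norm (grad F (xbar (path \<omega>) (t - 1))))\<^sup>2 \<partial>M)
    \<le> 2 * (1 - \<beta>) * (F x0 - F xstar) / (\<eta> * real T) + L * \<eta> * V1 / (real n * (1 - \<beta>)) + A * drift"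
proof -
  define P where "P t = (\<integral>\<omega>. (norm (grad F (xbar (path \<omega>) t)))\<^sup>2 \<partial>M)" for t
  define c where "c = 2 * (1 - \<beta>) / \<eta>"
  define b where "b = L * \<eta> * V1 / (real n * (1 - \<beta>))"
  have c: "0 \<le> c" and b: "0 \<le> b"
    using \<eta> \<beta>1 L_nonneg V1_nonneg by (simp_all add: c_def b_def)
  have "(\<Sum>t<T. P t) \<le> c * (F x0 - F xstar) + real T * (b + A * drift)"
  proof (cases "\<beta> ^ 4 \<le> 1 - L * (\<eta> / (1 - \<beta>))")
    case True
    have lt: "L * (\<eta> / (1 - \<beta>)) < 1"
      using le by linarith
    define E where "E t = (\<integral>\<omega>. F (y (path \<omega>) t) \<partial>M)" for t
    have "(\<Sum>t<T. P t) \<le> (\<Sum>t<T. c * (E t - E (Suc t)) + (b + A * drift))"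
    proof (rule sum_mono)
      fix t assume "t \<in> {..<T}"
      then show "P t \<le> c * (E t - E (Suc t)) + (b + A * drift)"
        using grad_norm_step [OF _ True lt, of t] by (simp add: P_def E_def c_def b_def add.assoc)
    qed
    also have "\<dots> = c * (E 0 - E T) + real T * (b + A * drift)"
      by (simp add: sum.distrib sum_distrib_left [symmetric] sum_lessThan_telescope')
    also have "E 0 = F x0"
      by (simp add: E_def y_0 prob_space)
    also have "c * (F x0 - E T) + real T * (b + A * drift) \<le> c * (F x0 - F xstar) + real T * (b + A * drift)"
    proof -
      have "F xstar \<le> E T"
        unfolding E_def using xstar by (intro integral_ge_const F_integrable y_sq_integrable) auto
      then show ?thesis
        using c by (simp add: mult_left_mono)
    qed
    finally show ?thesis .
  next
    case False
    \<comment> \<open>No telescoping here: every summand is already below \<open>A * drift\<close>,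
      and the remaining terms of the bound are nonnegative.\<close>
    have "(\<Sum>t<T. P t) \<le> (\<Sum>t<T. A * drift)"
      using grad_norm_large_step False le by (intro sum_mono) (auto simp: P_def)
    also have "\<dots> \<le> c * (F x0 - F xstar) + real T * (b + A * drift)"
      using c b xstar [of x0] by (simp add: distrib_left)
    finally show ?thesis .
  qed
  also have "(\<Sum>t<T. P t) = (\<Sum>t\<in>{1..T}. P (t - 1))"
    by (rule sum.reindex_bij_witness [where i = "\<lambda>t. t - 1" and j = Suc]) auto
  finally have "(1 / real T) * (\<Sum>t\<in>{1..T}. P (t - 1))
      \<le> (1 / real T) * (c * (F x0 - F xstar) + real T * (b + A * drift))"
    by (intro mult_left_mono) auto
  also have "\<dots> = c * (F x0 - F xstar) / real T + (b + A * drift)"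
    using T by (simp add: distrib_left)
  finally show ?thesis
    by (simp add: P_def c_def b_def)
qed

end


section \<open>The step size\<close>

text \<open>The denominator \<open>S + W\<close> of the step size balances three terms. The initial
  gap is divided by \<open>\<eta> * T\<close> and contributes \<open>S / T + W / T\<close>; the
  noise, linear in \<open>\<eta>\<close>, is matched to the first by
  \<open>S\<^sup>2 = T / n\<close>; the drift, quadratic in \<open>\<eta>\<close> with factor
  \<open>A\<close>, is matched to the second by \<open>W ^ 3 = A * T\<close>.\<close>

lemma rate_constants:
  fixes A :: real and n T :: nat
  assumes "0 < n" "0 < T" "1 \<le> A"
  defines "S \<equiv> sqrt (real T / real n)" and "W \<equiv> A powr (1 / 3) * real T powr (1 / 3)"
  shows "S / real T = 1 / sqrt (real n * real T)" "1 / (S * real n) = 1 / sqrt (real n * real T)"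
    "W / real T = A powr (1 / 3) / real T powr (2 / 3)" "A / W\<^sup>2 = A powr (1 / 3) / real T powr (2 / 3)"
    "0 < S" "0 < W"
proof -
  show S: "0 < S" and W: "0 < W"
    using assms by (simp_all add: S_def W_def)
  have nT: "sqrt (real n) * sqrt (real n) = real n" "sqrt (real T) * sqrt (real T) = real T"
    by simp_all
  have "S * sqrt (real n * real T) = real T"
    using assms nT by (simp add: S_def real_sqrt_divide real_sqrt_mult)
  then show "S / real T = 1 / sqrt (real n * real T)"
    using assms by (simp add: field_simps)
  have "sqrt (real n * real T) = S * real n"
  proof (rule real_sqrt_unique)
    show "(S * real n)\<^sup>2 = real n * real T"
      using assms(1) by (simp add: S_def power_mult_distrib) (simp add: power2_eq_square)
  qed (use S in simp)
  then show "1 / (S * real n) = 1 / sqrt (real n * real T)"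
    by simp
  have T: "real T powr (1 / 3) * real T powr (2 / 3) = real T" "(real T powr (1 / 3))\<^sup>2 = real T powr (2 / 3)"
    using assms by (simp_all add: powr_add [symmetric] power2_eq_square)
  have A: "(A powr (1 / 3))\<^sup>2 * A powr (1 / 3) = A"
    using assms by (simp add: powr_add [symmetric] power2_eq_square)
  have "W / real T = A powr (1 / 3) * real T powr (1 / 3) / (real T powr (1 / 3) * real T powr (2 / 3))"
    unfolding T(1) W_def ..
  also have "\<dots> = A powr (1 / 3) / real T powr (2 / 3)"
    using assms by simp
  finally show "W / real T = A powr (1 / 3) / real T powr (2 / 3)" .
  have "A / W\<^sup>2 = ((A powr (1 / 3))\<^sup>2 * A powr (1 / 3)) / ((A powr (1 / 3))\<^sup>2 * real T powr (2 / 3))"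
    unfolding A W_def power_mult_distrib T(2) ..
  also have "\<dots> = A powr (1 / 3) / real T powr (2 / 3)"
    using assms by simp
  finally show "A / W\<^sup>2 = A powr (1 / 3) / real T powr (2 / 3)" .
qed

text \<open>The sixth root of the hypothesis is
  \<open>sqrt n * A powr (1 / 3) \<le> T powr (1 / 6)\<close>; multiplying by \<open>sqrt T\<close>
  and rearranging gives the claim.\<close>

lemma rate_comparison:
  fixes A :: real and n T :: nat
  assumes "0 < n" "0 < T" "1 \<le> A" "real n ^ 3 * A\<^sup>2 \<le> real T"
  shows "A powr (1 / 3) / real T powr (2 / 3) \<le> 1 / sqrt (real n * real T)"
proof -
  have "(real n ^ 3 * A\<^sup>2) powr (1 / 6) \<le> real T powr (1 / 6)"
    using assms by (intro powr_mono2) auto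
  also have "(real n ^ 3 * A\<^sup>2) powr (1 / 6) = real n powr (1 / 2) * A powr (1 / 3)"
    using assms by (simp add: powr_mult powr_powr flip: powr_numeral)
  finally have "real n powr (1 / 2) * A powr (1 / 3) * real T powr (1 / 2) \<le> real T powr (1 / 6) * real T powr (1 / 2)"
    by (rule mult_right_mono) simp
  also have "\<dots> = real T powr (2 / 3)"
    by (simp add: powr_add [symmetric])
  finally have "A powr (1 / 3) * sqrt (real n * real T) \<le> real T powr (2 / 3)"
    using assms by (simp add: powr_half_sqrt real_sqrt_mult mult_ac)
  then show ?thesis
    using assms by (simp add: field_simps)
qed

lemma mcser_convergence:
  assumes params: "0 < \<delta>1" "0 < H" "0 \<le> \<beta>" "\<beta> < 1" "0 < \<gamma>" "0 < T"
    and A_eq: "A = error_const \<delta>1 \<delta>2 H" and V2_eq: "V2 = V1 + V1'"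
    and \<eta>_eq: "\<eta> = step_size \<gamma> A n T" and F_eq: "F = global_obj n D f"
    and asm: "mcser_assumptions L V1 V1' \<delta>1 \<delta>2 H \<beta> \<eta> n T C1 C2 M D f Z x0 xstar"
    and T_ge: "4 * \<gamma>\<^sup>2 * L\<^sup>2 * real n / (1 - \<beta>)\<^sup>2 \<le> real T"
    and uncapped: "uncapped_step \<gamma> A n T \<le> 1 / 2"
  shows "(\<forall>t\<in>{1..T}. integrable M (\<lambda>\<omega>. (norm (grad F (mcser_mean n H \<beta> \<eta> C1 C2 f x0 Z (t - 1) \<omega>)))\<^sup>2)) \<and>
    (1 / real T) * (\<Sum>t\<in>{1..T}. \<integral>\<omega>. (norm (grad F (mcser_mean n H \<beta> \<eta> C1 C2 f x0 Z (t - 1) \<omega>)))\<^sup>2 \<partial>M)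
      \<le> 1 / sqrt (real n * real T)
           * (2 * (1 - \<beta>) * (F x0 - F xstar) / \<gamma> + \<gamma> * L * V1 / (1 - \<beta>))
        + A powr (1 / 3) / real T powr (2 / 3)
           * (2 * (1 - \<beta>) * (F x0 - F xstar) / \<gamma> + \<gamma>\<^sup>2 * L\<^sup>2 * V2 / (1 - \<beta>) ^ 4)"
proof -
  have n: "0 < n" and "prob_space M" and \<delta>: "\<delta>1 \<le> 1" "0 \<le> \<delta>2" "\<delta>2 \<le> 1"
    using asm by (auto simp: mcser_assumptions_def stochastic_problem_def mcser_sampling_def approx_compressor_def)
  have A: "1 \<le> A"
    using \<delta> by (simp add: A_eq error_const_def)
  define S where "S = sqrt (real T / real n)"
  define W where "W = A powr (1 / 3) * real T powr (1 / 3)"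
  note rates = rate_constants [OF n params(6) A, folded S_def W_def]
  have \<eta>: "\<eta> = \<gamma> / (S + W)"
    using uncapped by (simp add: \<eta>_eq step_size_def uncapped_step_def S_def W_def)
  have "0 < \<eta>"
    using rates params by (simp add: \<eta>)
  interpret P: mcser_problem n H \<beta> \<eta> C1 C2 f x0 M L V1 V1' \<delta>1 \<delta>2 T D Z xstar
    by (intro mcser_problem.intro mcser_problem_axioms.intro \<open>prob_space M\<close> asm \<open>0 < \<eta>\<close>)
      (use params in auto)
  have defs: "P.F = F" "P.A = A" "P.V2 = V2"
    by (simp_all add: P.F_def F_eq P.A_def A_eq P.V2_def V2_eq)
  have \<eta>S: "\<eta> \<le> \<gamma> / S" and \<eta>W: "\<eta> \<le> \<gamma> / W"
    unfolding \<eta> using rates params by (intro divide_left_mono; simp)+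
  \<comment> \<open>The square root of the lower bound on \<open>T\<close>. As
    \<open>\<eta> \<le> \<gamma> / S\<close>, it is what keeps
    \<open>L * \<eta> / (1 - \<beta>)\<close> below one half.\<close>
  have "2 * \<gamma> * L / (1 - \<beta>) \<le> S"
    unfolding S_def
  proof (rule real_le_rsqrt)
    show "(2 * \<gamma> * L / (1 - \<beta>))\<^sup>2 \<le> real T / real n"
      using T_ge n by (simp add: pos_le_divide_eq power_mult_distrib power_divide)
  qed
  then have "L * (\<gamma> / S / (1 - \<beta>)) \<le> 1 / 2"
    using rates(5) params(4) by (simp add: field_simps)
  moreover have "L * (\<eta> / (1 - \<beta>)) \<le> L * (\<gamma> / S / (1 - \<beta>))"
    using \<eta>S P.L_nonneg params by (intro mult_left_mono divide_right_mono) auto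
  ultimately have "L * (\<eta> / (1 - \<beta>)) \<le> 1 / 2"
    by linarith
  from P.grad_norm_average [OF this]
  have avg: "(1 / real T) * (\<Sum>t\<in>{1..T}. \<integral>\<omega>. (norm (grad F (P.xbar (P.path \<omega>) (t - 1))))\<^sup>2 \<partial>M)
    \<le> 2 * (1 - \<beta>) * (F x0 - F xstar) / (\<eta> * real T) + L * \<eta> * V1 / (real n * (1 - \<beta>)) + A * P.drift"
    unfolding defs .
  have t1: "2 * (1 - \<beta>) * (F x0 - F xstar) / (\<eta> * real T)
      = 2 * (1 - \<beta>) * (F x0 - F xstar) / \<gamma> * (S / real T + W / real T)"
    using rates params by (simp add: \<eta> field_simps)
  have t2: "L * \<eta> * V1 / (real n * (1 - \<beta>)) \<le> 1 / (S * real n) * (\<gamma> * L * V1 / (1 - \<beta>))"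
  proof -
    have "L * V1 / (real n * (1 - \<beta>)) * \<eta> \<le> L * V1 / (real n * (1 - \<beta>)) * (\<gamma> / S)"
      using \<eta>S P.L_nonneg P.V1_nonneg params by (intro mult_left_mono) auto
    then show ?thesis
      by (simp add: mult_ac)
  qed
  have t3: "A * P.drift \<le> A / W\<^sup>2 * (\<gamma>\<^sup>2 * L\<^sup>2 * V2 / (1 - \<beta>) ^ 4)"
  proof -
    have "\<eta>\<^sup>2 \<le> (\<gamma> / W)\<^sup>2"
      using \<eta>W \<open>0 < \<eta>\<close> by (intro power_mono) auto
    then have "A * (L\<^sup>2 * V2 / (1 - \<beta>) ^ 4) * \<eta>\<^sup>2 \<le> A * (L\<^sup>2 * V2 / (1 - \<beta>) ^ 4) * (\<gamma> / W)\<^sup>2"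
      using A P.V2_nonneg params by (intro mult_left_mono) (auto simp: defs)
    then show ?thesis
      by (simp add: P.drift_def defs power_divide mult_ac)
  qed
  have "\<forall>t\<in>{1..T}. integrable M (\<lambda>\<omega>. (norm (grad F (P.xbar (P.path \<omega>) (t - 1))))\<^sup>2)"
    using P.grad_norm_integrable by (auto simp: defs)
  \<comment> \<open>Stated for arbitrary reals, so that the final algebra treats integrals and
    powers as atoms.\<close>
  moreover have combine: "X \<le> s * (c + b2) + r * (c + b3)"
    if "X \<le> y1 + y2 + y3" "y1 = c * (s + r)" "y2 \<le> s * b2" "y3 \<le> r * b3"
    for X s r c b2 b3 y1 y2 y3 :: real
    using that by (simp add: algebra_simps)
  ultimately show ?thesis
    unfolding P.mcser_mean_eq
    by (intro conjI combine [OF avg t1 [unfolded rates] t2 [unfolded rates] t3 [unfolded rates]])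
qed

text \<open>The order of quantifiers in the second part fixes the meaning of the asymptotic bound:
  \<open>K\<close> depends on the bound \<open>\<Delta>\<close> of the initial gap but not on
  \<open>n\<close>, and the threshold for \<open>T\<close> may depend on \<open>n\<close> but not on
  the objective, the data, the compressors or the starting point.\<close>

theorem corollary2:
  fixes L V1 V1' \<delta>1 \<delta>2 \<beta> \<gamma> :: real and H :: nat
  assumes "0 < \<delta>1" "\<delta>1 \<le> 1" "0 \<le> \<delta>2" "\<delta>2 \<le> 1" "0 < H" "0 \<le> \<beta>" "\<beta> < 1" "0 < \<gamma>"
  shows
    "(\<forall>(n::nat) (T::nat) C1 C2 (M :: 'w measure) (D :: nat \<Rightarrow> 'z measure)
        (f :: 'a::euclidean_space \<Rightarrow> 'z \<Rightarrow> real) Z x0 xstar.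
        let A = error_const \<delta>1 \<delta>2 H;
            V2 = V1 + V1';
            \<eta> = step_size \<gamma> A n T;
            F = global_obj n D f;
            xbar = mcser_mean n H \<beta> \<eta> C1 C2 f x0 Z
        in
          mcser_assumptions L V1 V1' \<delta>1 \<delta>2 H \<beta> \<eta> n T C1 C2 M D f Z x0 xstar \<longrightarrow>
          0 < T \<longrightarrow>
          real T \<ge> 4 * \<gamma>\<^sup>2 * L\<^sup>2 * real n / (1 - \<beta>)\<^sup>2 \<longrightarrow>
          uncapped_step \<gamma> A n T \<le> 1 / 2 \<longrightarrow>
          (\<forall>t\<in>{1..T}. integrable M (\<lambda>\<omega>. (norm (grad F (xbar (t - 1) \<omega>)))\<^sup>2)) \<and>
          (1 / real T) * (\<Sum>t\<in>{1..T}. \<integral>\<omega>. (norm (grad F (xbar (t - 1) \<omega>)))\<^sup>2 \<partial>M)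
            \<le> 1 / sqrt (real n * real T)
                 * (2 * (1 - \<beta>) * (F x0 - F xstar) / \<gamma> + \<gamma> * L * V1 / (1 - \<beta>))
              + A powr (1 / 3) / real T powr (2 / 3)
                 * (2 * (1 - \<beta>) * (F x0 - F xstar) / \<gamma> + \<gamma>\<^sup>2 * L\<^sup>2 * V2 / (1 - \<beta>) ^ 4))
     \<and>
     (\<forall>\<Delta>::real. \<exists>K::real. \<forall>n::nat. \<forall>\<^sub>F T in sequentially.
        \<forall>C1 C2 (M :: 'w measure) (D :: nat \<Rightarrow> 'z measure)
          (f :: 'a::euclidean_space \<Rightarrow> 'z \<Rightarrow> real) Z x0 xstar.
          let A = error_const \<delta>1 \<delta>2 H;
              \<eta> = step_size \<gamma> A n T;
              F = global_obj n D f;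
              xbar = mcser_mean n H \<beta> \<eta> C1 C2 f x0 Z
          in
            mcser_assumptions L V1 V1' \<delta>1 \<delta>2 H \<beta> \<eta> n T C1 C2 M D f Z x0 xstar \<longrightarrow>
            F x0 - F xstar \<le> \<Delta> \<longrightarrow>
            (\<forall>t\<in>{1..T}. integrable M (\<lambda>\<omega>. (norm (grad F (xbar (t - 1) \<omega>)))\<^sup>2)) \<and>
            (1 / real T) * (\<Sum>t\<in>{1..T}. \<integral>\<omega>. (norm (grad F (xbar (t - 1) \<omega>)))\<^sup>2 \<partial>M)
              \<le> K * (1 / sqrt (real n * real T)))"
    (is "?first \<and> ?second")
proof
  show ?first
    unfolding Let_def
    by (intro allI impI mcser_convergence [OF assms(1) assms(5) assms(6) assms(7) assms(8) _
          refl refl refl refl]) assumption+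
  show ?second
  proof
    fix \<Delta> :: real
    define A where "A = error_const \<delta>1 \<delta>2 H"
    \<comment> \<open>The two brackets of the bound as functions of the initial gap;
      \<open>K\<close> is the sum of their absolute values at \<open>\<Delta>\<close>. Absolute
      values are taken because \<open>\<Delta>\<close>, \<open>L\<close>, \<open>V1\<close> and
      \<open>V1'\<close> may have any sign until a problem instance is given.\<close>
    define B1 where "B1 = (\<lambda>\<Delta>. 2 * (1 - \<beta>) * \<Delta> / \<gamma> + \<gamma> * L * V1 / (1 - \<beta>))"
    define B2 where "B2 = (\<lambda>\<Delta>. 2 * (1 - \<beta>) * \<Delta> / \<gamma> + \<gamma>\<^sup>2 * L\<^sup>2 * (V1 + V1') / (1 - \<beta>) ^ 4)"
    have A: "1 \<le> A"
      using assms by (simp add: A_def error_const_def)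
    have mono: "B1 \<Delta>' \<le> B1 \<Delta>" "B2 \<Delta>' \<le> B2 \<Delta>" if "\<Delta>' \<le> \<Delta>" for \<Delta>'
      using that assms by (auto simp: B1_def B2_def intro!: divide_right_mono mult_left_mono)
    show "\<exists>K. \<forall>n. \<forall>\<^sub>F T in sequentially. \<forall>C1 C2 (M :: 'w measure) (D :: nat \<Rightarrow> 'z measure)
          (f :: 'a \<Rightarrow> 'z \<Rightarrow> real) Z x0 xstar.
          let A = error_const \<delta>1 \<delta>2 H;
              \<eta> = step_size \<gamma> A n T;
              F = global_obj n D f;
              xbar = mcser_mean n H \<beta> \<eta> C1 C2 f x0 Z
          in
            mcser_assumptions L V1 V1' \<delta>1 \<delta>2 H \<beta> \<eta> n T C1 C2 M D f Z x0 xstar \<longrightarrow>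
            F x0 - F xstar \<le> \<Delta> \<longrightarrow>
            (\<forall>t\<in>{1..T}. integrable M (\<lambda>\<omega>. (norm (grad F (xbar (t - 1) \<omega>)))\<^sup>2)) \<and>
            (1 / real T) * (\<Sum>t\<in>{1..T}. \<integral>\<omega>. (norm (grad F (xbar (t - 1) \<omega>)))\<^sup>2 \<partial>M)
              \<le> K * (1 / sqrt (real n * real T))"
      unfolding Let_def A_def [symmetric]
    proof (intro exI allI)
      fix n :: nat
      \<comment> \<open>The four thresholds ensure, in this order, that \<open>T\<close> is
        positive, that the step is small relative to \<open>L\<close>, that
        \<open>sqrt (T / n) \<ge> 2 * \<gamma>\<close> and hence the cap \<open>1 / 2\<close> is
        inactive, and that the slower-looking rate is dominated by
        \<open>1 / sqrt (n * T)\<close>.\<close>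
      define T0 where "T0 = nat \<lceil>Max {1, 4 * \<gamma>\<^sup>2 * L\<^sup>2 * real n / (1 - \<beta>)\<^sup>2, 4 * \<gamma>\<^sup>2 * real n, real n ^ 3 * A\<^sup>2}\<rceil>"
      show "\<forall>\<^sub>F T in sequentially. \<forall>C1 C2 (M :: 'w measure) (D :: nat \<Rightarrow> 'z measure)
          (f :: 'a \<Rightarrow> 'z \<Rightarrow> real) Z x0 xstar.
            mcser_assumptions L V1 V1' \<delta>1 \<delta>2 H \<beta> (step_size \<gamma> A n T) n T C1 C2 M D f Z x0 xstar \<longrightarrow>
            global_obj n D f x0 - global_obj n D f xstar \<le> \<Delta> \<longrightarrow>
            (\<forall>t\<in>{1..T}. integrable M (\<lambda>\<omega>. (norm (grad (global_obj n D f)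
                (mcser_mean n H \<beta> (step_size \<gamma> A n T) C1 C2 f x0 Z (t - 1) \<omega>)))\<^sup>2)) \<and>
            (1 / real T) * (\<Sum>t\<in>{1..T}. \<integral>\<omega>. (norm (grad (global_obj n D f)
                (mcser_mean n H \<beta> (step_size \<gamma> A n T) C1 C2 f x0 Z (t - 1) \<omega>)))\<^sup>2 \<partial>M)
              \<le> (\<bar>B1 \<Delta>\<bar> + \<bar>B2 \<Delta>\<bar>) * (1 / sqrt (real n * real T))"
        using eventually_ge_at_top [of T0]
      proof (eventually_elim, intro allI impI)
        fix T :: nat and C1 C2 :: "'a \<Rightarrow> 'a" and M :: "'w measure" and D :: "nat \<Rightarrow> 'z measure"
          and f :: "'a \<Rightarrow> 'z \<Rightarrow> real" and Z x0 xstar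
        assume "T0 \<le> T"
          and asm: "mcser_assumptions L V1 V1' \<delta>1 \<delta>2 H \<beta> (step_size \<gamma> A n T) n T C1 C2 M D f Z x0 xstar"
          and gap: "global_obj n D f x0 - global_obj n D f xstar \<le> \<Delta>"
        let ?d = "global_obj n D f x0 - global_obj n D f xstar"
        have "Max {1, 4 * \<gamma>\<^sup>2 * L\<^sup>2 * real n / (1 - \<beta>)\<^sup>2, 4 * \<gamma>\<^sup>2 * real n, real n ^ 3 * A\<^sup>2} \<le> real T"
          using \<open>T0 \<le> T\<close> unfolding T0_def by linarith
        then have T: "1 \<le> real T" "4 * \<gamma>\<^sup>2 * L\<^sup>2 * real n / (1 - \<beta>)\<^sup>2 \<le> real T"
          "4 * \<gamma>\<^sup>2 * real n \<le> real T" "real n ^ 3 * A\<^sup>2 \<le> real T"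
          by simp_all
        have n: "0 < n" and "0 < T"
          using asm T by (auto simp: mcser_assumptions_def stochastic_problem_def)
        have "uncapped_step \<gamma> A n T \<le> 1 / 2"
        proof -
          have "2 * \<gamma> \<le> sqrt (real T / real n)"
            using T(3) n by (intro real_le_rsqrt) (simp add: pos_le_divide_eq power_mult_distrib)
          also have "\<dots> \<le> sqrt (real T / real n) + A powr (1 / 3) * real T powr (1 / 3)"
            by simp
          finally show ?thesis
            using assms by (simp add: uncapped_step_def divide_le_eq)
        qed
        note conv = mcser_convergence [OF \<open>0 < \<delta>1\<close> \<open>0 < H\<close> \<open>0 \<le> \<beta>\<close> \<open>\<beta> < 1\<close> \<open>0 < \<gamma>\<close> \<open>0 < T\<close>
            A_def refl refl refl asm T(2) this]
        have "1 / sqrt (real n * real T) * B1 ?d + A powr (1 / 3) / real T powr (2 / 3) * B2 ?d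
            \<le> 1 / sqrt (real n * real T) * \<bar>B1 \<Delta>\<bar> + A powr (1 / 3) / real T powr (2 / 3) * \<bar>B2 \<Delta>\<bar>"
          using mono [OF gap] by (intro add_mono mult_left_mono) auto
        also have "\<dots> \<le> 1 / sqrt (real n * real T) * \<bar>B1 \<Delta>\<bar> + 1 / sqrt (real n * real T) * \<bar>B2 \<Delta>\<bar>"
          by (intro add_left_mono mult_right_mono rate_comparison n \<open>0 < T\<close> A T(4)) simp
        also have "\<dots> = (\<bar>B1 \<Delta>\<bar> + \<bar>B2 \<Delta>\<bar>) * (1 / sqrt (real n * real T))"
          by (simp add: add_divide_distrib)
        finally show "(\<forall>t\<in>{1..T}. integrable M (\<lambda>\<omega>. (norm (grad (global_obj n D f)
                (mcser_mean n H \<beta> (step_size \<gamma> A n T) C1 C2 f x0 Z (t - 1) \<omega>)))\<^sup>2)) \<and>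
            (1 / real T) * (\<Sum>t\<in>{1..T}. \<integral>\<omega>. (norm (grad (global_obj n D f)
                (mcser_mean n H \<beta> (step_size \<gamma> A n T) C1 C2 f x0 Z (t - 1) \<omega>)))\<^sup>2 \<partial>M)
              \<le> (\<bar>B1 \<Delta>\<bar> + \<bar>B2 \<Delta>\<bar>) * (1 / sqrt (real n * real T))"
          using conv unfolding B1_def B2_def by (meson order_trans)
      qed
    qed
  qed
qed

end
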